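(* Quasi-every $f\in\Omega$ satisfies $$\lim_{\varepsilon\to 0^+}\ \sup_{\substack{u,v\in[0,1]:\\ |u-v|\le\varepsilon}}\ \frac{|f(u)-f(v)|}{\sqrt{2\varepsilon\log(1/\varepsilon)}}=1 .$$ That is, the set $G$ of all $f\in\Omega$ for which this limit exists and equals $1$ holds quasi-surely: $\mathrm{Cap}(G^{\mathsf c})=0$.
   Context: $\Omega$ is the space of all continuous functions $f:[0,1]\to\mathbb{R}$, endowed with the topology of uniform convergence and its Borel $\sigma$-algebra. Let $W=\{W(s,t);\ s,t\ge 0\}$ be a real-valued two-parameter Brownian sheet, that is, a centered Gaussian process with continuous sample paths and covariance $\mathrm{E}[W(s,t)W(s',t')]=\min(s,s')\min(t,t')$. Define the Ornstein--Uhlenbeck Brownian sheet $U(s,t):=e^{-s/2}W(e^s,t)$ for $s,t\ge 0$, and the $\Omega$-valued process (the Ornstein--Uhlenbeck process on Wiener space) $Y_s:=U(s,\bullet)$, $s\ge 0$, where $U(s,\bullet)$ denotes the function $t\mapsto U(s,t)$, $t\in[0,1]$. For a Borel set $A\subseteq\Omega$, $\mathrm{Cap}(A)$ is the probability that $Y$, killed at an independent mean-one exponential random time, hits $A$; that is, $$\mathrm{Cap}(A):=\int_0^\infty e^{-s}\,\mathrm{P}\{\exists r\in[0,s]:\ Y_r\in A\}\,ds.$$ A Borel set $G\subseteq\Omega$ is said to hold quasi-surely (equivalently, quasi-every $f\in\Omega$ belongs to $G$) if $\mathrm{Cap}(G^{\mathsf c})=0$; equivalently, if $\mathrm{P}\{\forall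 s\ge 0:\ U(s,\bullet)\in G\}=1$. *)

theory Defs
  imports "HOL-Probability.Probability"
begin

(* The space of continuous functions [0,1] -> R with the uniform metric. Following the library's
   function spaces, its points are total functions that are extensional on {0..1}. *)
definition Omega :: "(real \<Rightarrow> real) metric" where
  "Omega = cfunspace (top_of_set {0..1}) euclidean_metric"

definition borel_Omega :: "(real \<Rightarrow> real) measure" where
  "borel_Omega = sigma (mspace Omega) {A. openin (mtopology_of Omega) A}"

(* Constants count as (degenerate) Gaussian variables. *)
definition gaussian_variable :: "'a measure \<Rightarrow> ('a \<Rightarrow> real) \<Rightarrow> bool" where
  "gaussian_variable M X \<longleftrightarrow>
     X \<in> borel_measurable M \<and>
     (\<exists>\<mu>. (AE \<omega> in M. X \<omega> = \<mu>) \<or>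
          (\<exists>\<sigma>>0. distributed M lborel X (\<lambda>x. ennreal (normal_density \<mu> \<sigma> x))))"

definition gaussian_process :: "'a measure \<Rightarrow> 'i set \<Rightarrow> ('i \<Rightarrow> 'a \<Rightarrow> real) \<Rightarrow> bool" where
  "gaussian_process M T X \<longleftrightarrow>
     (\<forall>I c. finite I \<and> I \<subseteq> T \<longrightarrow> gaussian_variable M (\<lambda>\<omega>. \<Sum>i\<in>I. c i * X i \<omega>))"

definition brownian_sheet :: "'a measure \<Rightarrow> (real \<Rightarrow> real \<Rightarrow> 'a \<Rightarrow> real) \<Rightarrow> bool" where
  "brownian_sheet M W \<longleftrightarrow>
     prob_space M \<and>
     gaussian_process M ({0..} \<times> {0..}) (\<lambda>(s, t). W s t) \<and>
     (\<forall>s\<ge>0. \<forall>t\<ge>0. prob_space.expectation M (W s t) = 0) \<and>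
     (\<forall>s\<ge>0. \<forall>t\<ge>0. \<forall>s'\<ge>0. \<forall>t'\<ge>0.
        prob_space.expectation M (\<lambda>\<omega>. W s t \<omega> * W s' t' \<omega>) = min s s' * min t t') \<and>
     (\<forall>\<omega>\<in>space M. continuous_on ({0..} \<times> {0..}) (\<lambda>(s, t). W s t \<omega>))"

definition OU_sheet :: "(real \<Rightarrow> real \<Rightarrow> 'a \<Rightarrow> real) \<Rightarrow> real \<Rightarrow> real \<Rightarrow> 'a \<Rightarrow> real" where
  "OU_sheet W s t \<omega> = exp (- s / 2) * W (exp s) t \<omega>"

definition OU_process :: "(real \<Rightarrow> real \<Rightarrow> 'a \<Rightarrow> real) \<Rightarrow> real \<Rightarrow> 'a \<Rightarrow> real \<Rightarrow> real" where
  "OU_process W s \<omega> = (\<lambda>t\<in>{0..1}. OU_sheet W s t \<omega>)"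

(* For a Borel set A the hitting event is a projection of a Borel set, hence belongs to the
   completion of M but perhaps not to M itself. The outer measure agrees with the completed
   probability there; the function "measure M" would return 0 on a non-measurable event. *)
definition Cap ::
  "'a measure \<Rightarrow> (real \<Rightarrow> real \<Rightarrow> 'a \<Rightarrow> real) \<Rightarrow> (real \<Rightarrow> real) set \<Rightarrow> ennreal" where
  "Cap M W A =
     (\<integral>\<^sup>+s\<in>{0..}. ennreal (exp (- s)) *
        outer_measure_of M {\<omega> \<in> space M. \<exists>r\<in>{0..s}. OU_process W r \<omega> \<in> A} \<partial>lborel)"

definition quasi_surely ::
  "'a measure \<Rightarrow> (real \<Rightarrow> real \<Rightarrow> 'a \<Rightarrow> real) \<Rightarrow> (real \<Rightarrow> real) set \<Rightarrow> bool" where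
  "quasi_surely M W G \<longleftrightarrow> G \<in> sets borel_Omega \<and> Cap M W (mspace Omega - G) = 0"

end

theory Submission
  imports Defs
begin

text \<open>For one fixed \<open>\<sigma>\<close>, \<open>t \<mapsto> W \<sigma> t\<close> is a Brownian motion of variance \<open>\<sigma>\<close>, and Levy's theorem follows
  from Gaussian tails on a grid together with chaining (upper bound) and from a second moment
  estimate for the number of large increments (lower bound); the latter needs only pairwise
  independence. To have the theorem for all \<open>\<sigma>\<close> at once, note that a rectangle increment over
  \<open>[\<sigma>, \<tau>] \<times> [u, v]\<close> has variance \<open>(\<tau> - \<sigma>) * (v - u)\<close>. A two-parameter chaining hence shows that the
  modulus of \<open>W \<tau> - W \<sigma>\<close> is at most \<open>\<eta>\<close> times Levy's scale simultaneously for all \<open>\<tau>\<close> in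
  \<open>[\<sigma>, \<sigma> + \<delta>]\<close>, where \<open>\<delta>\<close> depends on \<open>\<eta>\<close> only. So the rational \<open>\<sigma>\<close> suffice.\<close>

text \<open>Chaining loses a constant factor, whereas the limit must come out as exactly 1. Chaining
  is therefore applied only where the loss can be paid for: inside grid cells that are shorter than
  the scale by a large factor \<open>K\<close>, and over parameter intervals of small length
  \<open>\<delta>\<close>. The exact constant comes from Gaussian tails of single increments.
  Failure probabilities at scale \<open>\<epsilon>\<close> are bounded only by a small power of
  \<open>\<epsilon>\<close>, yet Borel-Cantelli needs them summable along the scales used; at the
  same time neighbouring scales must have ratio tending to 1, so that discretising costs nothing in
  the limit. The scales \<open>1 / k ^ p\<close> with large \<open>p\<close> do both. The path
  \<open>W \<sigma>\<close> has the constant \<open>sqrt \<sigma>\<close>, which is continuous in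
  \<open>\<sigma>\<close> and so survives the approximation; the factor \<open>exp (- s / 2)\<close>
  of the Ornstein-Uhlenbeck sheet turns it into 1. Since only real linear combinations are assumed
  Gaussian, independence of increments is recovered from covariances through characteristic
  functions.\<close>

section \<open>Exceptional events and chaining\<close>

text \<open>Stated through a measurable exceptional set, as \<open>Q\<close> will involve uncountable suprema.\<close>
definition fails_within :: "'a measure \<Rightarrow> real \<Rightarrow> ('a \<Rightarrow> bool) \<Rightarrow> bool" where
  "fails_within M p Q \<longleftrightarrow> (\<exists>E\<in>sets M. measure M E \<le> p \<and> (\<forall>\<omega>\<in>space M - E. Q \<omega>))"

lemma fails_within_mono:
  assumes "fails_within M p Q" "p \<le> q" "\<And>\<omega>. \<omega> \<in> space M \<Longrightarrow> Q \<omega> \<Longrightarrow> R \<omega>"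
  shows "fails_within M q R"
  using assms unfolding fails_within_def by (meson Diff_iff order_trans)

context prob_space
begin

lemma fails_within_trivial: "1 \<le> p \<Longrightarrow> fails_within M p Q"
  unfolding fails_within_def by (intro bexI[of _ "space M"]) (auto simp: prob_space)

lemma fails_within_all:
  fixes Q :: "nat \<Rightarrow> 'a \<Rightarrow> bool"
  assumes Q: "\<And>m. fails_within M (p m) (Q m)" and p: "p sums P"
  shows "fails_within M P (\<lambda>\<omega>. \<forall>m. Q m \<omega>)"
proof -
  from Q obtain E where E: "\<And>m. E m \<in> sets M" "\<And>m. prob (E m) \<le> p m"
      "\<And>m \<omega>. \<omega> \<in> space M - E m \<Longrightarrow> Q m \<omega>"
    unfolding fails_within_def by metis
  have s: "summable (\<lambda>m. prob (E m))"
    by (rule summable_comparison_test'[of p 0]) (use E p sums_summable in auto)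
  have "prob (\<Union>m. E m) \<le> (\<Sum>m. prob (E m))"
    using E s by (intro finite_measure_subadditive_countably) auto
  also have "\<dots> \<le> suminf p"
    using E p s by (intro suminf_le) (auto simp: sums_iff)
  also have "\<dots> = P" using p by (simp add: sums_iff)
  finally show ?thesis
    unfolding fails_within_def using E by (intro bexI[of _ "\<Union>m. E m"]) auto
qed

lemma fails_within_ball:
  assumes Q: "\<And>i. i \<in> I \<Longrightarrow> fails_within M p (Q i)" and "finite I" "real (card I) * p \<le> P"
  shows "fails_within M P (\<lambda>\<omega>. \<forall>i\<in>I. Q i \<omega>)"
proof -
  from Q have "\<forall>i. \<exists>E. i \<in> I \<longrightarrow> E \<in> sets M \<and> prob E \<le> p \<and> (\<forall>\<omega>\<in>space M - E. Q i \<omega>)"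
    unfolding fails_within_def by blast
  then obtain E where E: "\<And>i. i \<in> I \<Longrightarrow> E i \<in> sets M" "\<And>i. i \<in> I \<Longrightarrow> prob (E i) \<le> p"
      "\<And>i \<omega>. i \<in> I \<Longrightarrow> \<omega> \<in> space M - E i \<Longrightarrow> Q i \<omega>"
    by metis
  have "prob (\<Union>i\<in>I. E i) \<le> (\<Sum>i\<in>I. prob (E i))"
    using E assms by (intro finite_measure_subadditive_finite) auto
  also have "\<dots> \<le> (\<Sum>i\<in>I. p)" using E by (intro sum_mono) auto
  also have "\<dots> \<le> P" using assms by simp
  finally show ?thesis
    unfolding fails_within_def using E assms
    by (intro bexI[of _ "\<Union>i\<in>I. E i"]) auto
qed

lemma fails_within_conj:
  assumes "fails_within M p Q" "fails_within M q R"
  shows "fails_within M (p + q) (\<lambda>\<omega>. Q \<omega> \<and> R \<omega>)"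
proof -
  from assms obtain E F where EF: "E \<in> sets M" "prob E \<le> p" "\<forall>\<omega>\<in>space M - E. Q \<omega>"
      "F \<in> sets M" "prob F \<le> q" "\<forall>\<omega>\<in>space M - F. R \<omega>"
    unfolding fails_within_def by blast
  have "prob (E \<union> F) \<le> p + q"
    using measure_Un_le[of E M F] EF by linarith
  then show ?thesis
    unfolding fails_within_def using EF by (intro bexI[of _ "E \<union> F"]) auto
qed

lemma fails_within_eventually:
  assumes ev: "\<forall>\<^sub>F k in sequentially. fails_within M (p k) (Q k)" and p: "summable p"
  shows "AE \<omega> in M. \<forall>\<^sub>F k in sequentially. Q k \<omega>"
proof -
  obtain K where K: "\<And>k. k \<ge> K \<Longrightarrow> fails_within M (p k) (Q k)"
    using ev unfolding eventually_sequentially by blast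
  have "\<forall>k. \<exists>E. k \<ge> K \<longrightarrow> E \<in> sets M \<and> prob E \<le> p k \<and> (\<forall>\<omega>\<in>space M - E. Q k \<omega>)"
    using K unfolding fails_within_def by blast
  then obtain E where E: "\<And>k. k \<ge> K \<Longrightarrow> E k \<in> sets M" "\<And>k. k \<ge> K \<Longrightarrow> prob (E k) \<le> p k"
      "\<And>k \<omega>. k \<ge> K \<Longrightarrow> \<omega> \<in> space M - E k \<Longrightarrow> Q k \<omega>"
    by metis
  \<comment> \<open>Nothing is known about \<open>E k\<close> for \<open>k < K\<close>. The empty
    set stands in there, which does not affect what happens eventually.\<close>
  define F where "F k = (if k \<ge> K then E k else {})" for k
  have "AE \<omega> in M. \<forall>\<^sub>F k in sequentially. \<omega> \<in> space M - F k"
  proof (rule borel_cantelli_AE1)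
    show "F n \<in> sets M" for n using E by (auto simp: F_def)
    show "emeasure M (F n) < \<infinity>" for n by (simp add: less_top[symmetric])
    show "summable (\<lambda>n. prob (F n))"
      by (rule summable_comparison_test'[of p K]) (use E p in \<open>auto simp: F_def\<close>)
  qed
  then show ?thesis
  proof eventually_elim
    case (elim \<omega>)
    from elim eventually_ge_at_top[of K] show ?case
      by eventually_elim (use E in \<open>auto simp: F_def\<close>)
  qed
qed

end

text \<open>A level-\<open>m\<close> dyadic point is either a point of level \<open>m - 1\<close> or
  one level-\<open>m\<close> step to the right of one, so descending to level 0 costs at most
  \<open>c 0 + ... + c m\<close>. Rounding \<open>t\<close> down to each level and letting
  \<open>m\<close> grow transfers the bound to \<open>t\<close> by continuity.\<close>

lemma dyadic_chaining:
  fixes g :: "real \<Rightarrow> real"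
  assumes d: "d > 0" and cont: "continuous_on {a..a + d} g"
    and step: "\<And>m k. k < 2 ^ m \<Longrightarrow>
      \<bar>g (a + d * real (Suc k) / 2 ^ m) - g (a + d * real k / 2 ^ m)\<bar> \<le> c m"
    and C: "c sums C" and t: "t \<in> {a..a + d}"
  shows "\<bar>g t - g a\<bar> \<le> C"
proof -
  have c0: "0 \<le> c m" for m using order_trans[OF abs_ge_zero step[of 0 m]] by simp
  have grid: "\<bar>g (a + d * real k / 2 ^ m) - g a\<bar> \<le> (\<Sum>j\<le>m. c j)" if "k \<le> 2 ^ m" for m k
    using that
  proof (induction m arbitrary: k)
    case 0
    then have "k = 0 \<or> k = 1" by auto
    then show ?case using step[of 0 0] c0[of 0] by auto
  next
    case (Suc m)
    show ?case
    proof (cases "even k")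
      case True
      then obtain l where l: "k = 2 * l" by blast
      then have "l \<le> 2 ^ m" using Suc.prems by simp
      from Suc.IH[OF this] show ?thesis using c0[of "Suc m"] by (simp add: l)
    next
      case False
      then obtain l where l: "k = Suc (2 * l)" by (metis oddE Suc_eq_plus1)
      then have l2: "2 * l < 2 ^ Suc m" "l \<le> 2 ^ m" using Suc.prems by auto
      have e: "d * real (2 * l) / 2 ^ Suc m = d * real l / 2 ^ m" by simp
      have "\<bar>g (a + d * real k / 2 ^ Suc m) - g (a + d * real l / 2 ^ m)\<bar> \<le> c (Suc m)"
        using step[OF l2(1)] unfolding l e .
      with Suc.IH[OF l2(2)] show ?thesis by simp
    qed
  qed
  define x where "x = (t - a) / d"
  have x: "0 \<le> x" "x \<le> 1" "t = a + d * x" using t d by (auto simp: x_def field_simps)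
  define k where "k m = nat \<lfloor>2 ^ m * x\<rfloor>" for m :: nat
  define s where "s m = a + d * real (k m) / 2 ^ m" for m
  have k: "k m \<le> 2 ^ m" for m
  proof -
    have "2 ^ m * x \<le> real (2 ^ m)" using x by (simp add: mult_left_le)
    then show ?thesis unfolding k_def by linarith
  qed
  have rk: "real (k m) = of_int \<lfloor>2 ^ m * x\<rfloor>" for m
    unfolding k_def using x by simp
  have kx: "\<bar>real (k m) / 2 ^ m - x\<bar> \<le> (1/2) ^ m" for m
  proof -
    have "\<bar>real (k m) - 2 ^ m * x\<bar> \<le> 1" unfolding rk by linarith
    then have "\<bar>real (k m) - 2 ^ m * x\<bar> / 2 ^ m \<le> 1 / 2 ^ m" by (intro divide_right_mono) auto
    moreover have "real (k m) / 2 ^ m - x = (real (k m) - 2 ^ m * x) / 2 ^ m"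
      by (simp add: field_simps)
    ultimately show ?thesis by (simp add: power_one_over abs_divide)
  qed
  have "(\<lambda>m. real (k m) / 2 ^ m - x) \<longlonglongrightarrow> 0"
    by (rule Lim_null_comparison[where g = "\<lambda>m. (1/2) ^ m"])
      (use kx in \<open>auto intro!: LIMSEQ_power_zero\<close>)
  then have "(\<lambda>m. real (k m) / 2 ^ m) \<longlonglongrightarrow> x" by (simp add: LIM_zero_iff)
  then have "s \<longlonglongrightarrow> t"
    unfolding s_def x(3) by (subst times_divide_eq_right[symmetric]) (intro tendsto_intros)
  moreover have "s m \<in> {a..a + d}" for m
  proof -
    have "real (k m) \<le> 2 ^ m" using k[of m] by (metis of_nat_le_iff of_nat_numeral of_nat_power)
    then have "d * real (k m) \<le> d * 2 ^ m" using d by simp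
    then show ?thesis using d by (auto simp: s_def field_simps)
  qed
  ultimately have "(\<lambda>m. g (s m)) \<longlonglongrightarrow> g t"
    using t by (intro continuous_on_tendsto_compose[OF cont] always_eventually) auto
  then have lim: "(\<lambda>m. \<bar>g (s m) - g a\<bar>) \<longlonglongrightarrow> \<bar>g t - g a\<bar>" by (intro tendsto_intros)
  have "\<bar>g (s m) - g a\<bar> \<le> C" for m
  proof -
    have "\<bar>g (s m) - g a\<bar> \<le> (\<Sum>j\<le>m. c j)" using grid[OF k] unfolding s_def .
    also have "\<dots> \<le> C" using sum_le_suminf[of c "{..m}"] C c0 by (auto simp: sums_iff)
    finally show ?thesis .
  qed
  then show ?thesis by (intro LIMSEQ_le_const2[OF lim]) auto
qed

text \<open>The level-\<open>m\<close> increments are allowed the share \<open>x / 4 * (3 / 4) ^ m\<close> of the total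
  deviation \<open>x\<close>. As \<open>2 * (3 / 4)\<^sup>2 > 1\<close>, the exponents then grow with \<open>m\<close> and beat the number
  \<open>2 ^ m\<close> of increments. The uniformity in \<open>\<sigma>\<close> makes the lemma applicable to its own conclusion,
  which is how processes with two parameters are treated.\<close>
lemma (in prob_space) chaining:
  fixes X :: "real \<Rightarrow> 'b \<Rightarrow> 'a \<Rightarrow> real"
  assumes d: "d > 0" and A: "A \<ge> 1" and B: "B > 0" and x: "x > 0"
    and cont: "\<And>\<sigma> \<omega>. \<sigma> \<in> \<Sigma> \<Longrightarrow> \<omega> \<in> space M \<Longrightarrow> continuous_on {a..a + d} (\<lambda>t. X t \<sigma> \<omega>)"
    and tail: "\<And>s t x. a \<le> s \<Longrightarrow> s < t \<Longrightarrow> t \<le> a + d \<Longrightarrow> x > 0 \<Longrightarrow>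
      fails_within M (A * exp (- x\<^sup>2 / (B * (t - s)))) (\<lambda>\<omega>. \<forall>\<sigma>\<in>\<Sigma>. \<bar>X t \<sigma> \<omega> - X s \<sigma> \<omega>\<bar> \<le> x)"
  shows "fails_within M (4 * A * exp (- x\<^sup>2 / (128 * B * d)))
    (\<lambda>\<omega>. \<forall>t\<in>{a..a + d}. \<forall>\<sigma>\<in>\<Sigma>. \<bar>X t \<sigma> \<omega> - X a \<sigma> \<omega>\<bar> \<le> x)"
proof -
  \<comment> \<open>128 = 16 * 8: the 16 is the square of the 4 in the share \<open>x / 4\<close>,
    and the 8 is given away in \<open>(1 + m) / 8 \<le> (9/8) ^ m\<close>, which makes the exponent
    of level \<open>m\<close> at least \<open>z * (1 + m)\<close>.\<close>
  define z where "z = x\<^sup>2 / (128 * B * d)"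
  have z: "z > 0" using x B d by (simp add: z_def)
  show ?thesis
  \<comment> \<open>If \<open>exp (- z) > 1 / 4\<close>, the claimed bound exceeds 1, thanks to its
    factor 4. Otherwise the \<open>2 ^ m\<close> increments of level \<open>m\<close> together cost
    at most \<open>A * exp (- z) * (1/2) ^ m\<close>, which sums to twice the first term.\<close>
  proof (cases "exp (- z) \<le> 1 / 4")
    case False
    have "A * (4 * exp (- z)) \<ge> 1 * 1" by (rule mult_mono) (use False A in auto)
    then show ?thesis by (intro fails_within_trivial) (simp add: z_def)
  next
    case True
    define c where "c m = x / 4 * (3 / 4) ^ m" for m
    have c: "c sums x"
      using sums_mult[OF geometric_sums[of "3/4 :: real"], of "x / 4"] by (simp add: c_def[abs_def])
    define Q where "Q m \<omega> \<longleftrightarrow> (\<forall>k\<in>{..<2 ^ m}. \<forall>\<sigma>\<in>\<Sigma>.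
      \<bar>X (a + d * real (Suc k) / 2 ^ m) \<sigma> \<omega> - X (a + d * real k / 2 ^ m) \<sigma> \<omega>\<bar> \<le> c m)" for m :: nat and \<omega>
    have Q: "fails_within M (A * exp (- z) * (1 / 2) ^ m) (Q m)" for m
      unfolding Q_def
    proof (rule fails_within_ball)
      fix k :: nat assume "k \<in> {..<2 ^ m}"
      then have "Suc k \<le> 2 ^ m" by simp
      then have k: "real (Suc k) \<le> 2 ^ m" by (metis of_nat_le_iff of_nat_numeral of_nat_power)
      have "d * real (Suc k) \<le> d * 2 ^ m" using k d by simp
      then have up: "a + d * real (Suc k) / 2 ^ m \<le> a + d" by (simp add: field_simps)
      have diff: "(a + d * real (Suc k) / 2 ^ m) - (a + d * real k / 2 ^ m) = d / 2 ^ m"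
        by (simp add: field_simps)
      have lt: "a + d * real k / 2 ^ m < a + d * real (Suc k) / 2 ^ m"
        using d by (simp add: divide_strict_right_mono)
      have lo: "a \<le> a + d * real k / 2 ^ m" using d by simp
      have "c m > 0" using x by (simp add: c_def)
      from tail[OF lo lt up this, unfolded diff]
      show "fails_within M (A * exp (- (c m)\<^sup>2 / (B * (d / 2 ^ m))))
        (\<lambda>\<omega>. \<forall>\<sigma>\<in>\<Sigma>. \<bar>X (a + d * real (Suc k) / 2 ^ m) \<sigma> \<omega> - X (a + d * real k / 2 ^ m) \<sigma> \<omega>\<bar> \<le> c m)" .
    next
      have pw: "((3/4 :: real) ^ m)\<^sup>2 * 2 ^ m = (9/8) ^ m"
        unfolding power2_eq_square power_mult_distrib[symmetric] by simp
      have "(c m)\<^sup>2 / (B * (d / 2 ^ m)) = (x\<^sup>2 / (16 * B * d)) * (((3/4) ^ m)\<^sup>2 * 2 ^ m)"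
        by (simp add: c_def field_simps power2_eq_square)
      also have "\<dots> = 8 * z * (9/8) ^ m"
        unfolding pw by (simp add: z_def)
      also have "\<dots> \<ge> 8 * z * ((1 + real m) / 8)"
      proof (rule mult_left_mono)
        have "(1 + real m * (1/8)) \<le> (1 + 1/8 :: real) ^ m" by (rule Bernoulli_inequality) simp
        then show "(1 + real m) / 8 \<le> (9/8) ^ m" by simp
      qed (use z in simp)
      finally have "exp (- (c m)\<^sup>2 / (B * (d / 2 ^ m))) \<le> exp (- (z * (1 + real m)))"
        by simp
      also have "\<dots> = exp (- z) * exp (- z) ^ m"
        by (simp add: exp_of_nat_mult[symmetric] exp_add[symmetric] algebra_simps)
      also have "\<dots> \<le> exp (- z) * (1/4) ^ m"
        using True by (intro mult_left_mono power_mono) auto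
      finally have "2 ^ m * (A * exp (- (c m)\<^sup>2 / (B * (d / 2 ^ m)))) \<le> 2 ^ m * (A * (exp (- z) * (1/4) ^ m))"
        using A by (intro mult_left_mono) auto
      also have "\<dots> = A * exp (- z) * (2 ^ m * (1/4) ^ m)" by simp
      also have "2 ^ m * (1/4 :: real) ^ m = (1/2) ^ m" by (simp add: power_mult_distrib[symmetric])
      finally show "real (card {..<2 ^ m :: nat}) * (A * exp (- (c m)\<^sup>2 / (B * (d / 2 ^ m))))
          \<le> A * exp (- z) * (1 / 2) ^ m"
        by simp
    qed simp
    have "(\<lambda>m. A * exp (- z) * (1 / 2) ^ m) sums (A * exp (- z) * 2)"
      using sums_mult[OF geometric_sums[of "1/2 :: real"], of "A * exp (- z)"] by simp
    from fails_within_all[OF Q this] show ?thesis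
    proof (rule fails_within_mono)
      show "A * exp (- z) * 2 \<le> 4 * A * exp (- x\<^sup>2 / (128 * B * d))" using A by (simp add: z_def)
      fix \<omega> assume w: "\<omega> \<in> space M" "\<forall>m. Q m \<omega>"
      show "\<forall>t\<in>{a..a + d}. \<forall>\<sigma>\<in>\<Sigma>. \<bar>X t \<sigma> \<omega> - X a \<sigma> \<omega>\<bar> \<le> x"
      proof (intro ballI)
        fix t \<sigma> assume t: "t \<in> {a..a + d}" and \<sigma>: "\<sigma> \<in> \<Sigma>"
        show "\<bar>X t \<sigma> \<omega> - X a \<sigma> \<omega>\<bar> \<le> x"
          by (rule dyadic_chaining[OF d cont[OF \<sigma> w(1)] _ c t]) (use w(2) \<sigma> in \<open>auto simp: Q_def\<close>)
      qed
    qed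
  qed
qed

section \<open>Gaussian variables\<close>

text \<open>A pointwise Chernoff bound: moving the centre to the point \<open>x\<close> or
  \<open>- x\<close> on the side of \<open>y\<close> gains the factor
  \<open>exp (- x^2 / (2 * \<sigma>^2))\<close>. Adding both shifted densities covers both signs of
  \<open>y\<close>, and the right-hand side integrates to a constant without any estimate of a
  Gaussian integral.\<close>

lemma normal_density_tail:
  assumes \<sigma>: "\<sigma> > 0" and x: "0 \<le> x" "x \<le> \<bar>y\<bar>"
  shows "normal_density 0 \<sigma> y
    \<le> exp (- x\<^sup>2 / (2 * \<sigma>\<^sup>2)) * (normal_density x \<sigma> y + normal_density (- x) \<sigma> y)"
proof -
  have "normal_density 0 \<sigma> y \<le> exp (- x\<^sup>2 / (2 * \<sigma>\<^sup>2)) * normal_density (sgn y * x) \<sigma> y"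
  proof -
    have "x * x \<le> x * \<bar>y\<bar>" using x by (intro mult_left_mono) auto
    moreover have "(sgn y * x)\<^sup>2 \<le> x\<^sup>2"
      by (auto simp: sgn_real_def power2_eq_square)
    moreover have "(y - sgn y * x)\<^sup>2 = y\<^sup>2 - 2 * (x * \<bar>y\<bar>) + (sgn y * x)\<^sup>2"
      by (simp add: power2_eq_square algebra_simps abs_sgn)
    ultimately have "x\<^sup>2 + (y - sgn y * x)\<^sup>2 \<le> y\<^sup>2" by (simp add: power2_eq_square)
    then have "- y\<^sup>2 / (2 * \<sigma>\<^sup>2) \<le> (- x\<^sup>2 - (y - sgn y * x)\<^sup>2) / (2 * \<sigma>\<^sup>2)"
      by (intro divide_right_mono) auto
    then have "exp (- y\<^sup>2 / (2 * \<sigma>\<^sup>2)) \<le> exp (- x\<^sup>2 / (2 * \<sigma>\<^sup>2)) * exp (- (y - sgn y * x)\<^sup>2 / (2 * \<sigma>\<^sup>2))"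
      by (simp add: exp_add[symmetric] diff_divide_distrib)
    then have "1 / sqrt (2 * pi * \<sigma>\<^sup>2) * exp (- y\<^sup>2 / (2 * \<sigma>\<^sup>2)) \<le>
        1 / sqrt (2 * pi * \<sigma>\<^sup>2) * (exp (- x\<^sup>2 / (2 * \<sigma>\<^sup>2)) * exp (- (y - sgn y * x)\<^sup>2 / (2 * \<sigma>\<^sup>2)))"
      by (intro mult_left_mono) auto
    then show ?thesis by (simp add: normal_density_def mult_ac)
  qed
  also have "normal_density (sgn y * x) \<sigma> y \<le> normal_density x \<sigma> y + normal_density (- x) \<sigma> y"
    using normal_density_pos[OF \<sigma>, of x y] normal_density_pos[OF \<sigma>, of "- x" y] x
    by (cases "y = 0"; cases "y > 0") (auto simp: less_imp_le)
  finally show ?thesis by (simp add: mult_left_mono)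
qed

context prob_space
begin

lemma normal_tail:
  assumes X: "distributed M lborel X (\<lambda>x. ennreal (normal_density 0 \<sigma> x))" and \<sigma>: "\<sigma> > 0" and x: "0 \<le> x"
  shows "prob {\<omega>\<in>space M. x \<le> \<bar>X \<omega>\<bar>} \<le> 2 * exp (- x\<^sup>2 / (2 * \<sigma>\<^sup>2))"
proof -
  let ?A = "{y :: real. x \<le> \<bar>y\<bar>}" and ?e = "exp (- x\<^sup>2 / (2 * \<sigma>\<^sup>2))"
  have "emeasure M (X -` ?A \<inter> space M) = (\<integral>\<^sup>+y. ennreal (normal_density 0 \<sigma> y) * indicator ?A y \<partial>lborel)"
    by (rule distributed_emeasure[OF X]) simp
  also have "\<dots> \<le> (\<integral>\<^sup>+y. ennreal (?e * (normal_density x \<sigma> y + normal_density (- x) \<sigma> y)) \<partial>lborel)"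
    using normal_density_tail[OF \<sigma> x]
    by (intro nn_integral_mono) (auto split: split_indicator intro!: ennreal_leI)
  also have "\<dots> = ennreal (?e * (1 + 1))"
    using \<sigma> by (subst nn_integral_eq_integral) auto
  finally have "prob (X -` ?A \<inter> space M) \<le> ?e * (1 + 1)"
    by (simp add: emeasure_eq_measure)
  moreover have "X -` ?A \<inter> space M = {\<omega>\<in>space M. x \<le> \<bar>X \<omega>\<bar>}" by auto
  ultimately show ?thesis by simp
qed

text \<open>Only the mass on \<open>[m, m + 1]\<close> is kept, where the density is at least its
  value at the right end. The loss is a factor \<open>exp (- m)\<close> up to constants, which is
  small against \<open>exp (- m^2 / 2)\<close> raised to any small power.\<close>

lemma std_normal_tail_lower:
  assumes X: "distributed M lborel X (\<lambda>x. ennreal (std_normal_density x))" and m: "0 \<le> m"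
  shows "exp (- (m + 1)\<^sup>2 / 2) / sqrt (2 * pi) \<le> prob {\<omega>\<in>space M. m \<le> X \<omega>}"
proof -
  let ?c = "exp (- (m + 1)\<^sup>2 / 2) / sqrt (2 * pi)"
  have "ennreal ?c = (\<integral>\<^sup>+y. ennreal ?c * indicator {m..m + 1} y \<partial>lborel)"
    using m by (subst nn_integral_cmult_indicator) auto
  also have "\<dots> \<le> (\<integral>\<^sup>+y. ennreal (std_normal_density y) * indicator {m..} y \<partial>lborel)"
  proof (intro nn_integral_mono)
    fix y :: real
    have "?c \<le> std_normal_density y" if "m \<le> y" "y \<le> m + 1"
      using that m by (auto simp: std_normal_density_def intro!: divide_right_mono power_mono)
    then show "ennreal ?c * indicator {m..m + 1} y \<le> ennreal (std_normal_density y) * indicator {m..} y"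
      by (auto split: split_indicator intro!: ennreal_leI)
  qed
  also have "\<dots> = emeasure M (X -` {m..} \<inter> space M)"
    by (rule distributed_emeasure[OF X, symmetric]) simp
  finally have "?c \<le> prob (X -` {m..} \<inter> space M)"
    by (simp add: emeasure_eq_measure)
  moreover have "X -` {m..} \<inter> space M = {\<omega>\<in>space M. m \<le> X \<omega>}" by auto
  ultimately show ?thesis by simp
qed

lemma gaussian_variable_square_integrable:
  assumes "gaussian_variable M X"
  shows "integrable M (\<lambda>\<omega>. (X \<omega>)\<^sup>2)"
proof -
  have [measurable]: "X \<in> borel_measurable M" using assms by (simp add: gaussian_variable_def)
  from assms consider \<mu> where "AE \<omega> in M. X \<omega> = \<mu>" |
    \<mu> \<sigma> where "\<sigma> > 0" "distributed M lborel X (\<lambda>x. ennreal (normal_density \<mu> \<sigma> x))"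
    unfolding gaussian_variable_def by blast
  then show ?thesis
  proof cases
    case (1 \<mu>)
    have "integrable M (\<lambda>\<omega>. (X \<omega>)\<^sup>2) \<longleftrightarrow> integrable M (\<lambda>\<omega>. \<mu>\<^sup>2)"
      using 1 by (intro integrable_cong_AE) auto
    then show ?thesis by simp
  next
    case (2 \<mu> \<sigma>)
    \<comment> \<open>\<open>x^2\<close> is expanded about \<open>\<mu>\<close> because the
      available moments are the central ones.\<close>
    have "integrable lborel (\<lambda>x. normal_density \<mu> \<sigma> x * (x - \<mu>) ^ 2
        + 2 * \<mu> * (normal_density \<mu> \<sigma> x * (x - \<mu>) ^ 1) + \<mu>\<^sup>2 * normal_density \<mu> \<sigma> x)"
      using 2 by (intro Bochner_Integration.integrable_add integrable_mult_right
        integrable_normal_moment integrable_normal_density)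
    also have "(\<lambda>x. normal_density \<mu> \<sigma> x * (x - \<mu>) ^ 2
        + 2 * \<mu> * (normal_density \<mu> \<sigma> x * (x - \<mu>) ^ 1) + \<mu>\<^sup>2 * normal_density \<mu> \<sigma> x)
      = (\<lambda>x. normal_density \<mu> \<sigma> x * x\<^sup>2)"
      by (auto simp: power2_eq_square algebra_simps)
    finally show ?thesis
      using distributed_integrable[OF 2(2), of "\<lambda>x. x\<^sup>2"] by simp
  qed
qed

lemma gaussian_variable_centered:
  assumes X: "gaussian_variable M X" and m: "expectation X = 0" and v: "expectation (\<lambda>\<omega>. (X \<omega>)\<^sup>2) = v"
    and pos: "v > 0"
  shows "distributed M lborel X (\<lambda>x. ennreal (normal_density 0 (sqrt v) x))"
proof -
  have [measurable]: "X \<in> borel_measurable M" using X by (simp add: gaussian_variable_def)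
  from X consider \<mu> where "AE \<omega> in M. X \<omega> = \<mu>" |
    \<mu> \<sigma> where "\<sigma> > 0" "distributed M lborel X (\<lambda>x. ennreal (normal_density \<mu> \<sigma> x))"
    unfolding gaussian_variable_def by blast
  then show ?thesis
  proof cases
    case (1 \<mu>)
    have "expectation X = expectation (\<lambda>\<omega>. \<mu>)" using 1 by (intro integral_cong_AE) auto
    moreover have "expectation (\<lambda>\<omega>. (X \<omega>)\<^sup>2) = expectation (\<lambda>\<omega>. \<mu>\<^sup>2)"
      using 1 by (intro integral_cong_AE) auto
    ultimately show ?thesis using m v pos by (simp add: prob_space)
  next
    case (2 \<mu> \<sigma>)
    have "\<mu> = 0" using normal_distributed_expectation[OF 2] m by simp
    moreover have "\<sigma>\<^sup>2 = v" using normal_distributed_variance[OF 2] m v by simp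
    then have "\<sigma> = sqrt v" using 2 by (simp add: real_sqrt_unique)
    ultimately show ?thesis using 2 by simp
  qed
qed

text \<open>The degenerate case \<open>v = 0\<close> is included since the formula will be applied
  to all combinations \<open>a * X + b * Y\<close>, also those that vanish.\<close>

lemma expectation_iexp_gaussian:
  assumes X: "gaussian_variable M X" and m: "expectation X = 0" and v: "expectation (\<lambda>\<omega>. (X \<omega>)\<^sup>2) = v"
  shows "(CLINT \<omega>|M. iexp (X \<omega>)) = exp (- v / 2)"
proof (cases "v = 0")
  case True
  have [measurable]: "X \<in> borel_measurable M" using X by (simp add: gaussian_variable_def)
  have "AE \<omega> in M. (X \<omega>)\<^sup>2 = 0"
    using integral_nonneg_eq_0_iff_AE[OF gaussian_variable_square_integrable[OF X]] v True by simp
  then have "(CLINT \<omega>|M. iexp (X \<omega>)) = (CLINT \<omega>|M. 1)"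
    by (intro integral_cong_AE) auto
  then show ?thesis using True by (simp add: prob_space)
next
  case False
  have [measurable]: "X \<in> borel_measurable M" using X by (simp add: gaussian_variable_def)
  have "0 \<le> v" unfolding v[symmetric] by (intro Bochner_Integration.integral_nonneg) auto
  with False have pos: "v > 0" by simp
  let ?Y = "\<lambda>\<omega>. (X \<omega> - 0) / sqrt v"
  have Y: "distributed M lborel ?Y (\<lambda>x. ennreal (std_normal_density x))"
    using gaussian_variable_centered[OF assms pos] normal_standard_normal_convert[of "sqrt v" X 0] pos by simp
  then have "distr M borel ?Y = std_normal_distribution"
    unfolding distributed_def by (simp cong: distr_cong)
  then have "char (distr M borel ?Y) (sqrt v) = exp (- ((sqrt v)\<^sup>2) / 2)"
    by (simp add: char_std_normal_distribution)
  moreover have "char (distr M borel ?Y) (sqrt v) = (CLINT \<omega>|M. iexp (X \<omega>))"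
    using pos by (simp add: char_def integral_distr)
  ultimately show ?thesis using pos by (simp add: exp_of_real[symmetric])
qed

text \<open>By hypothesis \<open>X\<close> has the same Fourier transform, hence the same law, under \<open>M\<close> and under \<open>M\<close>
  reweighted by the positive density proportional to \<open>2 + Z\<close>.\<close>
lemma expectation_indicator_mult:
  assumes [measurable]: "random_variable borel X" "random_variable borel Z" "A \<in> sets borel"
    and Z: "\<And>\<omega>. \<bar>Z \<omega>\<bar> \<le> 1"
    and char: "\<And>a. (CLINT \<omega>|M. iexp (a * X \<omega>) * of_real (Z \<omega>)) = (CLINT \<omega>|M. iexp (a * X \<omega>)) * of_real (expectation Z)"
  shows "expectation (\<lambda>\<omega>. indicator A (X \<omega>) * Z \<omega>) = prob (X -` A \<inter> space M) * expectation Z"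
proof -
  have iZ: "integrable M Z" by (rule integrable_const_bound[of _ 1]) (use Z in auto)
  have "\<bar>expectation Z\<bar> \<le> 1"
  proof -
    have "\<bar>expectation Z\<bar> \<le> expectation (\<lambda>\<omega>. \<bar>Z \<omega>\<bar>)" by (rule integral_abs_bound)
    also have "\<dots> \<le> expectation (\<lambda>\<omega>. 1)" using iZ Z by (intro integral_mono) auto
    finally show ?thesis by (simp add: prob_space)
  qed
  \<comment> \<open>Since \<open>Z\<close> is at least -1, adding 2 keeps both the weight and its
    normalisation at least 1.\<close>
  define c where "c = 2 + expectation Z"
  have c: "c > 0" using \<open>\<bar>expectation Z\<bar> \<le> 1\<close> by (simp add: c_def)
  define w where "w \<omega> = (2 + Z \<omega>) / c" for \<omega>
  have w0: "0 \<le> w \<omega>" for \<omega> using Z[of \<omega>] c by (simp add: w_def)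
  have [measurable]: "w \<in> borel_measurable M" unfolding w_def by measurable
  have iw: "integrable M w" unfolding w_def using iZ by simp
  have Ew: "expectation w = 1"
    unfolding w_def using iZ c by (simp add: prob_space c_def)
  define N where "N = density M (\<lambda>\<omega>. ennreal (w \<omega>))"
  have sN[simp]: "space N = space M" "sets N = sets M" by (simp_all add: N_def)
  have XN[measurable]: "X \<in> borel_measurable N" by (simp add: N_def)
  interpret N: prob_space N
  proof
    have "emeasure N (space M) = (\<integral>\<^sup>+\<omega>. ennreal (w \<omega>) \<partial>M)"
      unfolding N_def by (subst emeasure_density) (auto intro!: nn_integral_cong)
    also have "\<dots> = 1" using iw w0 Ew by (subst nn_integral_eq_integral) auto
    finally show "emeasure N (space N) = 1" by simp
  qed
  have "char (distr N borel X) = char (distr M borel X)"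
  proof
    fix a
    have ie: "integrable M (\<lambda>\<omega>. iexp (a * X \<omega>))"
      by (rule integrable_const_bound[of _ 1]) auto
    have ieZ: "integrable M (\<lambda>\<omega>. iexp (a * X \<omega>) * of_real (Z \<omega>))"
      by (rule integrable_const_bound[of _ 1]) (use Z in \<open>auto simp: norm_mult\<close>)
    have "char (distr N borel X) a = (CLINT \<omega>|N. iexp (a * X \<omega>))"
      by (simp add: char_def integral_distr)
    also have "\<dots> = (CLINT \<omega>|M. w \<omega> *\<^sub>R iexp (a * X \<omega>))"
      unfolding N_def using w0 by (subst integral_density) auto
    also have "\<dots> = (CLINT \<omega>|M. (2 * iexp (a * X \<omega>) + iexp (a * X \<omega>) * of_real (Z \<omega>)) / of_real c)"
      by (intro Bochner_Integration.integral_cong) (auto simp: w_def scaleR_conv_of_real algebra_simps)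
    also have "\<dots> = (2 * (CLINT \<omega>|M. iexp (a * X \<omega>)) + (CLINT \<omega>|M. iexp (a * X \<omega>) * of_real (Z \<omega>))) / of_real c"
      using ie ieZ by simp
    also have "\<dots> = (CLINT \<omega>|M. iexp (a * X \<omega>)) * of_real c / of_real c"
      unfolding char by (simp add: c_def algebra_simps)
    also have "\<dots> = char (distr M borel X) a"
      using c by (simp add: char_def integral_distr)
    finally show "char (distr N borel X) a = char (distr M borel X) a" .
  qed
  then have eq: "distr N borel X = distr M borel X"
    by (intro Levy_uniqueness) (auto intro!: real_distribution_distr N.real_distribution_distr)
  have "prob (X -` A \<inter> space M) = measure (distr M borel X) A"
    by (simp add: measure_distr)
  also have "\<dots> = measure N (X -` A \<inter> space N)"
    unfolding eq[symmetric] by (simp add: measure_distr)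
  also have "\<dots> = expectation (\<lambda>\<omega>. w \<omega> * indicator A (X \<omega>))"
  proof -
    have "emeasure N (X -` A \<inter> space N) = (\<integral>\<^sup>+\<omega>. ennreal (w \<omega> * indicator A (X \<omega>)) \<partial>M)"
      unfolding N_def by (subst emeasure_density) (auto intro!: nn_integral_cong split: split_indicator)
    also have "\<dots> = ennreal (expectation (\<lambda>\<omega>. w \<omega> * indicator A (X \<omega>)))"
      using w0 by (intro nn_integral_eq_integral Bochner_Integration.integrable_bound[OF iw])
        (auto split: split_indicator)
    finally show ?thesis
      using w0 by (simp add: N.emeasure_eq_measure)
  qed
  also have "\<dots> = expectation (\<lambda>\<omega>. (2 * indicator A (X \<omega>) + indicator A (X \<omega>) * Z \<omega>) / c)"
    by (intro Bochner_Integration.integral_cong) (auto simp: w_def algebra_simps)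
  also have "\<dots> = (2 * expectation (\<lambda>\<omega>. indicator A (X \<omega>)) + expectation (\<lambda>\<omega>. indicator A (X \<omega>) * Z \<omega>)) / c"
  proof -
    have "integrable M (\<lambda>\<omega>. indicator A (X \<omega>) :: real)"
      by (rule integrable_const_bound[of _ 1]) auto
    moreover have "integrable M (\<lambda>\<omega>. indicator A (X \<omega>) * Z \<omega>)"
      by (rule integrable_const_bound[of _ 1]) (use Z in \<open>auto split: split_indicator\<close>)
    ultimately show ?thesis by simp
  qed
  also have "expectation (\<lambda>\<omega>. indicator A (X \<omega>)) = prob (X -` A \<inter> space M)"
  proof -
    have "expectation (\<lambda>\<omega>. indicator A (X \<omega>) :: real) = expectation (indicator (X -` A \<inter> space M))"
      by (intro Bochner_Integration.integral_cong) (auto split: split_indicator)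
    then show ?thesis by simp
  qed
  \<comment> \<open>With \<open>P\<close> the probability and \<open>E\<close> the unknown
    expectation, the chain reads \<open>P = (2 * P + E) / c\<close>; solving it gives
    \<open>E = P * (c - 2)\<close>.\<close>
  finally show ?thesis using c by (simp add: field_simps c_def)
qed

text \<open>Uniqueness of characteristic functions on the line is enough, when used twice. First
  \<open>Z\<close> is \<open>cos (b * Y)\<close> and \<open>sin (b * Y)\<close>, tested against the
  law of \<open>X\<close>. The result says that \<open>indicator A (X \<omega>)\<close> factors
  against every \<open>iexp (b * Y)\<close>, so it can serve as \<open>Z\<close> against the law of
  \<open>Y\<close>. The exponential is split into cosine and sine because \<open>Z\<close> has to be
  real.\<close>

lemma prob_conj_of_char:
  assumes [measurable]: "random_variable borel X" "random_variable borel Y" "A \<in> sets borel" "B \<in> sets borel"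
    and char: "\<And>a b. (CLINT \<omega>|M. iexp (a * X \<omega> + b * Y \<omega>)) = (CLINT \<omega>|M. iexp (a * X \<omega>)) * (CLINT \<omega>|M. iexp (b * Y \<omega>))"
  shows "prob {\<omega>\<in>space M. X \<omega> \<in> A \<and> Y \<omega> \<in> B} = prob {\<omega>\<in>space M. X \<omega> \<in> A} * prob {\<omega>\<in>space M. Y \<omega> \<in> B}"
proof -
  have int: "integrable M (\<lambda>\<omega>. iexp (a * X \<omega> + b * Y \<omega>))" for a b
    by (rule integrable_const_bound[of _ 1]) auto
  have intY: "integrable M (\<lambda>\<omega>. iexp (b * Y \<omega>))" for b
    by (rule integrable_const_bound[of _ 1]) auto
  have intcs: "integrable M (\<lambda>\<omega>. cos (b * Y \<omega>))" "integrable M (\<lambda>\<omega>. sin (b * Y \<omega>))" for b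
    by (rule integrable_const_bound[of _ 1]; auto)+
  have cos_eq: "complex_of_real (cos x) = (iexp x + iexp (- x)) / 2" for x
    by (simp add: cos_exp_eq cos_of_real[symmetric])
  have sin_eq: "complex_of_real (sin x) = (iexp x - iexp (- x)) / (2 * \<i>)" for x
    by (simp add: sin_exp_eq sin_of_real[symmetric] algebra_simps)
  have add: "iexp (x + y) = iexp x * iexp y" for x y
    by (simp add: exp_add[symmetric] algebra_simps)
  have prod: "(CLINT \<omega>|M. iexp (a * X \<omega>) * iexp (b * Y \<omega>)) = (CLINT \<omega>|M. iexp (a * X \<omega>)) * (CLINT \<omega>|M. iexp (b * Y \<omega>))"
    and intp: "integrable M (\<lambda>\<omega>. iexp (a * X \<omega>) * iexp (b * Y \<omega>))" for a b
    using char[of a b] int[of a b] unfolding add by simp_all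
  have c: "expectation (\<lambda>\<omega>. indicator A (X \<omega>) * cos (b * Y \<omega>)) = prob (X -` A \<inter> space M) * expectation (\<lambda>\<omega>. cos (b * Y \<omega>))" for b
  proof (rule expectation_indicator_mult)
    fix a
    have "(CLINT \<omega>|M. iexp (a * X \<omega>) * of_real (cos (b * Y \<omega>)))
       = (CLINT \<omega>|M. (iexp (a * X \<omega>) * iexp (b * Y \<omega>) + iexp (a * X \<omega>) * iexp (- b * Y \<omega>)) / 2)"
      unfolding cos_eq by (intro Bochner_Integration.integral_cong) (auto simp: algebra_simps)
    also have "\<dots> = (CLINT \<omega>|M. iexp (a * X \<omega>)) * (((CLINT \<omega>|M. iexp (b * Y \<omega>)) + (CLINT \<omega>|M. iexp (- b * Y \<omega>))) / 2)"
      using intp[of a b] intp[of a "- b"] prod[of a b] prod[of a "- b"] by (simp add: algebra_simps)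
    also have "((CLINT \<omega>|M. iexp (b * Y \<omega>)) + (CLINT \<omega>|M. iexp (- b * Y \<omega>))) / 2 = (CLINT \<omega>|M. of_real (cos (b * Y \<omega>)))"
      unfolding cos_eq using intY[of b] intY[of "- b"] by simp
    finally show "(CLINT \<omega>|M. iexp (a * X \<omega>) * of_real (cos (b * Y \<omega>)))
       = (CLINT \<omega>|M. iexp (a * X \<omega>)) * of_real (expectation (\<lambda>\<omega>. cos (b * Y \<omega>)))"
      by simp
  qed auto
  have s: "expectation (\<lambda>\<omega>. indicator A (X \<omega>) * sin (b * Y \<omega>)) = prob (X -` A \<inter> space M) * expectation (\<lambda>\<omega>. sin (b * Y \<omega>))" for b
  proof (rule expectation_indicator_mult)
    fix a
    have "(CLINT \<omega>|M. iexp (a * X \<omega>) * of_real (sin (b * Y \<omega>)))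
       = (CLINT \<omega>|M. (iexp (a * X \<omega>) * iexp (b * Y \<omega>) - iexp (a * X \<omega>) * iexp (- b * Y \<omega>)) / (2 * \<i>))"
      unfolding sin_eq by (intro Bochner_Integration.integral_cong) (auto simp: algebra_simps diff_divide_distrib)
    also have "\<dots> = (CLINT \<omega>|M. iexp (a * X \<omega>)) * (((CLINT \<omega>|M. iexp (b * Y \<omega>)) - (CLINT \<omega>|M. iexp (- b * Y \<omega>))) / (2 * \<i>))"
      using intp[of a b] intp[of a "- b"] prod[of a b] prod[of a "- b"] by (simp add: algebra_simps diff_divide_distrib)
    also have "((CLINT \<omega>|M. iexp (b * Y \<omega>)) - (CLINT \<omega>|M. iexp (- b * Y \<omega>))) / (2 * \<i>) = (CLINT \<omega>|M. of_real (sin (b * Y \<omega>)))"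
      unfolding sin_eq using intY[of b] intY[of "- b"] by simp
    finally show "(CLINT \<omega>|M. iexp (a * X \<omega>) * of_real (sin (b * Y \<omega>)))
       = (CLINT \<omega>|M. iexp (a * X \<omega>)) * of_real (expectation (\<lambda>\<omega>. sin (b * Y \<omega>)))"
      by simp
  qed auto
  have PA: "expectation (\<lambda>\<omega>. indicator A (X \<omega>)) = prob (X -` A \<inter> space M)"
  proof -
    have "expectation (\<lambda>\<omega>. indicator A (X \<omega>) :: real) = expectation (indicator (X -` A \<inter> space M))"
      by (intro Bochner_Integration.integral_cong) (auto split: split_indicator)
    then show ?thesis by simp
  qed
  have "expectation (\<lambda>\<omega>. indicator B (Y \<omega>) * indicator A (X \<omega>)) = prob (Y -` B \<inter> space M) * expectation (\<lambda>\<omega>. indicator A (X \<omega>))"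
  proof (rule expectation_indicator_mult)
    fix b
    have ics: "integrable M (\<lambda>\<omega>. indicator A (X \<omega>) * cos (b * Y \<omega>))" "integrable M (\<lambda>\<omega>. indicator A (X \<omega>) * sin (b * Y \<omega>))"
      by (rule integrable_const_bound[of _ 1]; auto split: split_indicator)+
    have iexp_eq: "iexp x = of_real (cos x) + \<i> * of_real (sin x)" for x
      by (simp add: exp_Euler cos_of_real sin_of_real)
    have "(CLINT \<omega>|M. iexp (b * Y \<omega>) * of_real (indicator A (X \<omega>)))
      = (CLINT \<omega>|M. of_real (indicator A (X \<omega>) * cos (b * Y \<omega>)) + \<i> * of_real (indicator A (X \<omega>) * sin (b * Y \<omega>)))"
      unfolding iexp_eq by (intro Bochner_Integration.integral_cong) (auto simp: algebra_simps)
    also have "\<dots> = of_real (expectation (\<lambda>\<omega>. indicator A (X \<omega>) * cos (b * Y \<omega>)))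
        + \<i> * of_real (expectation (\<lambda>\<omega>. indicator A (X \<omega>) * sin (b * Y \<omega>)))"
      using ics by (subst Bochner_Integration.integral_add) (auto simp del: of_real_mult)
    also have "\<dots> = of_real (prob (X -` A \<inter> space M)) *
        (of_real (expectation (\<lambda>\<omega>. cos (b * Y \<omega>))) + \<i> * of_real (expectation (\<lambda>\<omega>. sin (b * Y \<omega>))))"
      unfolding c s by (simp add: algebra_simps)
    also have "of_real (expectation (\<lambda>\<omega>. cos (b * Y \<omega>))) + \<i> * of_real (expectation (\<lambda>\<omega>. sin (b * Y \<omega>)))
        = (CLINT \<omega>|M. iexp (b * Y \<omega>))"
      unfolding iexp_eq using intcs by (subst Bochner_Integration.integral_add) auto
    finally show "(CLINT \<omega>|M. iexp (b * Y \<omega>) * of_real (indicator A (X \<omega>)))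
      = (CLINT \<omega>|M. iexp (b * Y \<omega>)) * of_real (expectation (\<lambda>\<omega>. indicator A (X \<omega>)))"
      unfolding PA by simp
  qed (auto split: split_indicator)
  moreover have "expectation (\<lambda>\<omega>. indicator B (Y \<omega>) * indicator A (X \<omega>)) = prob {\<omega>\<in>space M. X \<omega> \<in> A \<and> Y \<omega> \<in> B}"
  proof -
    have "expectation (\<lambda>\<omega>. indicator B (Y \<omega>) * indicator A (X \<omega>) :: real) = expectation (indicator {\<omega>\<in>space M. X \<omega> \<in> A \<and> Y \<omega> \<in> B})"
      by (intro Bochner_Integration.integral_cong) (auto split: split_indicator)
    then show ?thesis by (simp add: Int_absorb2)
  qed
  moreover have "X -` A \<inter> space M = {\<omega>\<in>space M. X \<omega> \<in> A}" "Y -` B \<inter> space M = {\<omega>\<in>space M. Y \<omega> \<in> B}" by auto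
  ultimately show ?thesis using PA by simp
qed

end

section \<open>The Gaussian space of the Brownian sheet\<close>

locale sheet =
  fixes M :: "'a measure" and W :: "real \<Rightarrow> real \<Rightarrow> 'a \<Rightarrow> real"
  assumes sheet: "brownian_sheet M W"
begin

sublocale prob_space M
  using sheet by (simp add: brownian_sheet_def)

text \<open>Every member is a centred Gaussian variable, so questions about laws reduce to computing
  covariances. The uncurried form of \<open>W\<close> is the one to which
  \<open>gaussian_process\<close> applies literally.\<close>

definition lin_span :: "('a \<Rightarrow> real) set" where
  "lin_span = {X. \<exists>I c. finite I \<and> I \<subseteq> {0..} \<times> {0..} \<and> X = (\<lambda>\<omega>. \<Sum>i\<in>I. c i * (\<lambda>(s, t). W s t) i \<omega>)}"

lemma lin_span_W: "0 \<le> s \<Longrightarrow> 0 \<le> t \<Longrightarrow> W s t \<in> lin_span"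
  unfolding lin_span_def by (intro CollectI exI[of _ "{(s, t)}"] exI[of _ "\<lambda>_. 1"]) auto

lemma lin_span_scale: "X \<in> lin_span \<Longrightarrow> (\<lambda>\<omega>. a * X \<omega>) \<in> lin_span"
proof -
  assume "X \<in> lin_span"
  then obtain I c where Ic: "finite I" "I \<subseteq> {0..} \<times> {0..}" "X = (\<lambda>\<omega>. \<Sum>i\<in>I. c i * (\<lambda>(s, t). W s t) i \<omega>)"
    unfolding lin_span_def by blast
  then show "(\<lambda>\<omega>. a * X \<omega>) \<in> lin_span"
    unfolding lin_span_def
    by (intro CollectI exI[of _ I] exI[of _ "\<lambda>i. a * c i"]) (auto simp: sum_distrib_left mult.assoc)
qed

lemma lin_span_add: "X \<in> lin_span \<Longrightarrow> Y \<in> lin_span \<Longrightarrow> (\<lambda>\<omega>. X \<omega> + Y \<omega>) \<in> lin_span"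
proof -
  assume "X \<in> lin_span" "Y \<in> lin_span"
  then obtain I c J d where Ic: "finite I" "I \<subseteq> {0..} \<times> {0..}" "X = (\<lambda>\<omega>. \<Sum>i\<in>I. c i * (\<lambda>(s, t). W s t) i \<omega>)"
    and Jd: "finite J" "J \<subseteq> {0..} \<times> {0..}" "Y = (\<lambda>\<omega>. \<Sum>i\<in>J. d i * (\<lambda>(s, t). W s t) i \<omega>)"
    unfolding lin_span_def by blast
  \<comment> \<open>Both coefficient families are extended by zero to the common index set.\<close>
  let ?e = "\<lambda>i. (if i \<in> I then c i else 0) + (if i \<in> J then d i else 0)"
  have "X \<omega> + Y \<omega> = (\<Sum>i\<in>I \<union> J. ?e i * (\<lambda>(s, t). W s t) i \<omega>)" for \<omega>
  proof -
    have "X \<omega> = (\<Sum>i\<in>I \<union> J. (if i \<in> I then c i else 0) * (\<lambda>(s, t). W s t) i \<omega>)"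
      unfolding Ic(3) using Ic(1) Jd(1) by (intro sum.mono_neutral_cong_left) auto
    moreover have "Y \<omega> = (\<Sum>i\<in>I \<union> J. (if i \<in> J then d i else 0) * (\<lambda>(s, t). W s t) i \<omega>)"
      unfolding Jd(3) using Ic(1) Jd(1) by (intro sum.mono_neutral_cong_left) auto
    ultimately show ?thesis by (simp add: sum.distrib[symmetric] distrib_right)
  qed
  then show "(\<lambda>\<omega>. X \<omega> + Y \<omega>) \<in> lin_span"
    unfolding lin_span_def using Ic Jd
    by (intro CollectI exI[of _ "I \<union> J"] exI[of _ ?e]) auto
qed

lemma lin_span_diff: "X \<in> lin_span \<Longrightarrow> Y \<in> lin_span \<Longrightarrow> (\<lambda>\<omega>. X \<omega> - Y \<omega>) \<in> lin_span"
  using lin_span_add[OF _ lin_span_scale[of Y "- 1"]] by simp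

lemma gaussian_lin_span: "X \<in> lin_span \<Longrightarrow> gaussian_variable M X"
  using sheet unfolding brownian_sheet_def gaussian_process_def lin_span_def by blast

lemma measurable_lin_span: "X \<in> lin_span \<Longrightarrow> X \<in> borel_measurable M"
  using gaussian_lin_span by (simp add: gaussian_variable_def)

lemma integrable_mult_lin_span:
  assumes "X \<in> lin_span" "Y \<in> lin_span"
  shows "integrable M (\<lambda>\<omega>. X \<omega> * Y \<omega>)"
proof (rule Bochner_Integration.integrable_bound)
  note [measurable] = assms[THEN measurable_lin_span]
  show "integrable M (\<lambda>\<omega>. (X \<omega>)\<^sup>2 + (Y \<omega>)\<^sup>2)"
    using assms by (intro Bochner_Integration.integrable_add gaussian_variable_square_integrable gaussian_lin_span)
  show "(\<lambda>\<omega>. X \<omega> * Y \<omega>) \<in> borel_measurable M" by measurable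
  have "\<bar>x * y\<bar> \<le> x\<^sup>2 + y\<^sup>2" for x y :: real
  proof -
    have "2 * (\<bar>x\<bar> * \<bar>y\<bar>) \<le> x\<^sup>2 + y\<^sup>2" using sum_squares_bound[of "\<bar>x\<bar>" "\<bar>y\<bar>"] by (simp add: mult.assoc)
    moreover have "0 \<le> \<bar>x\<bar> * \<bar>y\<bar>" by simp
    ultimately show ?thesis unfolding abs_mult by linarith
  qed
  then show "AE \<omega> in M. norm (X \<omega> * Y \<omega>) \<le> norm ((X \<omega>)\<^sup>2 + (Y \<omega>)\<^sup>2)" by simp
qed

lemma integrable_lin_span: "X \<in> lin_span \<Longrightarrow> integrable M X"
  using gaussian_variable_square_integrable[OF gaussian_lin_span] square_integrable_imp_integrable[OF measurable_lin_span]
  by blast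

lemma expectation_lin_span: "X \<in> lin_span \<Longrightarrow> expectation X = 0"
proof -
  assume "X \<in> lin_span"
  then obtain I c where Ic: "finite I" "I \<subseteq> {0..} \<times> {0..}" "X = (\<lambda>\<omega>. \<Sum>i\<in>I. c i * (\<lambda>(s, t). W s t) i \<omega>)"
    unfolding lin_span_def by blast
  have W: "(\<lambda>(s, t). W s t) i \<in> lin_span" "expectation ((\<lambda>(s, t). W s t) i) = 0" if "i \<in> I" for i
    using that Ic sheet lin_span_W by (auto simp: brownian_sheet_def)
  then have "expectation X = (\<Sum>i\<in>I. c i * expectation ((\<lambda>(s, t). W s t) i))"
    unfolding Ic(3) using integrable_lin_span by (subst Bochner_Integration.integral_sum) auto
  then show ?thesis using W by simp
qed

definition cov :: "('a \<Rightarrow> real) \<Rightarrow> ('a \<Rightarrow> real) \<Rightarrow> real" where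
  "cov X Y = expectation (\<lambda>\<omega>. X \<omega> * Y \<omega>)"

lemma cov_W: "0 \<le> s \<Longrightarrow> 0 \<le> t \<Longrightarrow> 0 \<le> s' \<Longrightarrow> 0 \<le> t' \<Longrightarrow> cov (W s t) (W s' t') = min s s' * min t t'"
  using sheet by (simp add: cov_def brownian_sheet_def)

lemma cov_diff:
  assumes "X \<in> lin_span" "Y \<in> lin_span" "Z \<in> lin_span"
  shows "cov (\<lambda>\<omega>. X \<omega> - Y \<omega>) Z = cov X Z - cov Y Z" "cov Z (\<lambda>\<omega>. X \<omega> - Y \<omega>) = cov Z X - cov Z Y"
  using assms by (simp_all add: cov_def algebra_simps integrable_mult_lin_span)

lemma cov_add:
  assumes "X \<in> lin_span" "Y \<in> lin_span" "Z \<in> lin_span"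
  shows "cov (\<lambda>\<omega>. X \<omega> + Y \<omega>) Z = cov X Z + cov Y Z" "cov Z (\<lambda>\<omega>. X \<omega> + Y \<omega>) = cov Z X + cov Z Y"
  using assms by (simp_all add: cov_def algebra_simps integrable_mult_lin_span)

lemma cov_scale: "cov (\<lambda>\<omega>. a * X \<omega>) Z = a * cov X Z" "cov Z (\<lambda>\<omega>. a * X \<omega>) = a * cov Z X"
  by (simp_all add: cov_def mult.assoc mult.left_commute[of _ a])

lemma cov_sym: "cov X Y = cov Y X"
  by (simp add: cov_def mult.commute)

lemma lin_span_tail:
  assumes X: "X \<in> lin_span" and v: "cov X X = v" "v > 0" and x: "x > 0"
  shows "fails_within M (2 * exp (- x\<^sup>2 / (2 * v))) (\<lambda>\<omega>. \<bar>X \<omega>\<bar> \<le> x)"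
proof -
  note [measurable] = measurable_lin_span[OF X]
  have "distributed M lborel X (\<lambda>x. ennreal (normal_density 0 (sqrt v) x))"
    using gaussian_lin_span[OF X] expectation_lin_span[OF X] v
    by (intro gaussian_variable_centered) (auto simp: cov_def power2_eq_square)
  from normal_tail[OF this, of x] have "prob {\<omega>\<in>space M. x \<le> \<bar>X \<omega>\<bar>} \<le> 2 * exp (- x\<^sup>2 / (2 * v))"
    using v x by simp
  then show ?thesis
    unfolding fails_within_def by (intro bexI[of _ "{\<omega>\<in>space M. x \<le> \<bar>X \<omega>\<bar>}"]) auto
qed

lemma iexp_lin_span: "X \<in> lin_span \<Longrightarrow> (CLINT \<omega>|M. iexp (X \<omega>)) = exp (- cov X X / 2)"
  using expectation_iexp_gaussian[OF gaussian_lin_span expectation_lin_span]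
  by (simp add: cov_def power2_eq_square)

text \<open>Uncorrelated members of a Gaussian space are independent: \<open>a * X + b * Y\<close>
  is again in the span, its variance is the sum of the two variances, and so its characteristic
  function is a product.\<close>

lemma prob_conj_lin_span:
  assumes X: "X \<in> lin_span" and Y: "Y \<in> lin_span" and c: "cov X Y = 0" and AB: "A \<in> sets borel" "B \<in> sets borel"
  shows "prob {\<omega>\<in>space M. X \<omega> \<in> A \<and> Y \<omega> \<in> B} = prob {\<omega>\<in>space M. X \<omega> \<in> A} * prob {\<omega>\<in>space M. Y \<omega> \<in> B}"
proof (rule prob_conj_of_char[OF measurable_lin_span[OF X] measurable_lin_span[OF Y] AB])
  fix a b
  have aX: "(\<lambda>\<omega>. a * X \<omega>) \<in> lin_span" and bY: "(\<lambda>\<omega>. b * Y \<omega>) \<in> lin_span"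
    using X Y by (simp_all add: lin_span_scale)
  have "cov (\<lambda>\<omega>. a * X \<omega> + b * Y \<omega>) (\<lambda>\<omega>. a * X \<omega> + b * Y \<omega>)
      = cov (\<lambda>\<omega>. a * X \<omega>) (\<lambda>\<omega>. a * X \<omega>) + cov (\<lambda>\<omega>. b * Y \<omega>) (\<lambda>\<omega>. b * Y \<omega>)"
    using c cov_sym[of X Y] by (simp add: cov_add aX bY X Y lin_span_add cov_scale)
  then show "(CLINT \<omega>|M. iexp (a * X \<omega> + b * Y \<omega>)) = (CLINT \<omega>|M. iexp (a * X \<omega>)) * (CLINT \<omega>|M. iexp (b * Y \<omega>))"
    using iexp_lin_span[OF aX] iexp_lin_span[OF bY] iexp_lin_span[OF lin_span_add[OF aX bY]]
    by (simp add: exp_add[symmetric] add_divide_distrib diff_divide_distrib of_real_mult[symmetric] del: of_real_mult)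
qed

section \<open>Path continuity, covariances of increments and tails of suprema\<close>

lemma continuous_W: "\<omega> \<in> space M \<Longrightarrow> continuous_on ({0..} \<times> {0..}) (\<lambda>(s, t). W s t \<omega>)"
  using sheet by (simp add: brownian_sheet_def)

lemma continuous_W_left: "\<omega> \<in> space M \<Longrightarrow> t \<ge> 0 \<Longrightarrow> continuous_on {0..} (\<lambda>s. W s t \<omega>)"
proof -
  assume "\<omega> \<in> space M" "t \<ge> 0"
  then have "continuous_on {0..} (\<lambda>s. (\<lambda>(s, t). W s t \<omega>) (s, t))"
    by (intro continuous_on_compose2[OF continuous_W] continuous_intros) auto
  then show ?thesis by simp
qed

lemma continuous_W_right: "\<omega> \<in> space M \<Longrightarrow> s \<ge> 0 \<Longrightarrow> continuous_on {0..} (\<lambda>t. W s t \<omega>)"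
proof -
  assume "\<omega> \<in> space M" "s \<ge> 0"
  then have "continuous_on {0..} (\<lambda>t. (\<lambda>(s, t). W s t \<omega>) (s, t))"
    by (intro continuous_on_compose2[OF continuous_W] continuous_intros) auto
  then show ?thesis by simp
qed

lemma cov_increment:
  assumes "0 \<le> \<sigma>" "0 \<le> s" "s \<le> t"
  shows "cov (\<lambda>\<omega>. W \<sigma> t \<omega> - W \<sigma> s \<omega>) (\<lambda>\<omega>. W \<sigma> t \<omega> - W \<sigma> s \<omega>) = \<sigma> * (t - s)"
  using assms
  by (simp add: cov_diff cov_W lin_span_W lin_span_diff min_absorb1 min_absorb2; simp add: algebra_simps)

lemma cov_disjoint_increments:
  assumes "0 \<le> \<sigma>" "0 \<le> s" "s \<le> t" "t \<le> s'" "s' \<le> t'"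
  shows "cov (\<lambda>\<omega>. W \<sigma> t \<omega> - W \<sigma> s \<omega>) (\<lambda>\<omega>. W \<sigma> t' \<omega> - W \<sigma> s' \<omega>) = 0"
  using assms
  by (simp add: cov_diff cov_W lin_span_W lin_span_diff min_absorb1 min_absorb2; simp add: algebra_simps)

lemma cov_rectangle:
  assumes "0 \<le> \<sigma>" "\<sigma> \<le> \<tau>" "0 \<le> s" "s \<le> t"
  shows "cov (\<lambda>\<omega>. (W \<tau> t \<omega> - W \<tau> s \<omega>) - (W \<sigma> t \<omega> - W \<sigma> s \<omega>))
             (\<lambda>\<omega>. (W \<tau> t \<omega> - W \<tau> s \<omega>) - (W \<sigma> t \<omega> - W \<sigma> s \<omega>)) = (\<tau> - \<sigma>) * (t - s)"
  using assms
  by (simp add: cov_diff cov_W lin_span_W lin_span_diff min_absorb1 min_absorb2; simp add: algebra_simps)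

text \<open>Chaining in \<open>\<tau>\<close>: for fixed \<open>s\<close> and \<open>t\<close>, the
  increments of \<open>W \<tau> t - W \<tau> s\<close> over \<open>[a, b]\<close> have variance
  \<open>(b - a) * (t - s)\<close>, so \<open>A = 2\<close> and \<open>B = 2 * (t - s)\<close>,
  whence 8 = 4 * 2 and 256 = 128 * 2. The index set \<open>{()}\<close> says that no further
  parameter is present.\<close>

lemma rectangle_tail:
  assumes \<sigma>: "0 \<le> \<sigma>" and \<delta>: "\<delta> > 0" and st: "0 \<le> s" "s < t" and x: "x > 0"
  shows "fails_within M (8 * exp (- x\<^sup>2 / (256 * (t - s) * \<delta>)))
    (\<lambda>\<omega>. \<forall>\<tau>\<in>{\<sigma>..\<sigma> + \<delta>}. \<bar>(W \<tau> t \<omega> - W \<tau> s \<omega>) - (W \<sigma> t \<omega> - W \<sigma> s \<omega>)\<bar> \<le> x)"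
proof -
  have "fails_within M (4 * 2 * exp (- x\<^sup>2 / (128 * (2 * (t - s)) * \<delta>)))
    (\<lambda>\<omega>. \<forall>\<tau>\<in>{\<sigma>..\<sigma> + \<delta>}. \<forall>_\<in>{()}. \<bar>(W \<tau> t \<omega> - W \<tau> s \<omega>) - (W \<sigma> t \<omega> - W \<sigma> s \<omega>)\<bar> \<le> x)"
  proof (rule chaining[where X = "\<lambda>\<tau> _ \<omega>. W \<tau> t \<omega> - W \<tau> s \<omega>", OF \<delta>])
    show "continuous_on {\<sigma>..\<sigma> + \<delta>} (\<lambda>\<tau>. W \<tau> t \<omega> - W \<tau> s \<omega>)" if "\<omega> \<in> space M" for \<omega>
      using that \<sigma> st
      by (intro continuous_intros continuous_on_subset[OF continuous_W_left[of \<omega>]]) auto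
    fix a b y assume a: "\<sigma> \<le> a" "a < b" and y: "(y :: real) > 0"
    have "(\<lambda>\<omega>. (W b t \<omega> - W b s \<omega>) - (W a t \<omega> - W a s \<omega>)) \<in> lin_span"
      using a \<sigma> st by (intro lin_span_diff lin_span_W) auto
    moreover have "0 < (b - a) * (t - s)" using a st by simp
    moreover have e: "2 * ((b - a) * (t - s)) = 2 * (t - s) * (b - a)" by simp
    ultimately show "fails_within M (2 * exp (- y\<^sup>2 / (2 * (t - s) * (b - a))))
       (\<lambda>\<omega>. \<forall>_\<in>{()}. \<bar>(W b t \<omega> - W b s \<omega>) - (W a t \<omega> - W a s \<omega>)\<bar> \<le> y)"
      using lin_span_tail[OF _ cov_rectangle[of a b s t] _ y] a \<sigma> st unfolding e by simp
  qed (use st x in auto)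
  then show ?thesis by (simp add: mult.assoc)
qed

text \<open>Chaining in \<open>t\<close>, with \<open>\<tau>\<close> now as the uniform parameter.
  The hypothesis on tails is \<open>rectangle_tail\<close> with \<open>A = 8\<close> and
  \<open>B = 256 * \<delta>\<close>, whence 32 = 4 * 8 and 32768 = 128 * 256. What matters is that
  \<open>\<delta>\<close> and \<open>d\<close> enter through their product.\<close>

lemma rectangle_sup_tail:
  assumes \<sigma>: "0 \<le> \<sigma>" and \<delta>: "\<delta> > 0" and a: "0 \<le> a" and d: "d > 0" and x: "x > 0"
  shows "fails_within M (32 * exp (- x\<^sup>2 / (32768 * \<delta> * d)))
    (\<lambda>\<omega>. \<forall>t\<in>{a..a + d}. \<forall>\<tau>\<in>{\<sigma>..\<sigma> + \<delta>}. \<bar>(W \<tau> t \<omega> - W \<sigma> t \<omega>) - (W \<tau> a \<omega> - W \<sigma> a \<omega>)\<bar> \<le> x)"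
proof -
  have "fails_within M (4 * 8 * exp (- x\<^sup>2 / (128 * (256 * \<delta>) * d)))
    (\<lambda>\<omega>. \<forall>t\<in>{a..a + d}. \<forall>\<tau>\<in>{\<sigma>..\<sigma> + \<delta>}. \<bar>(W \<tau> t \<omega> - W \<sigma> t \<omega>) - (W \<tau> a \<omega> - W \<sigma> a \<omega>)\<bar> \<le> x)"
  proof (rule chaining[where X = "\<lambda>t \<tau> \<omega>. W \<tau> t \<omega> - W \<sigma> t \<omega>", OF d])
    show "continuous_on {a..a + d} (\<lambda>t. W \<tau> t \<omega> - W \<sigma> t \<omega>)" if "\<omega> \<in> space M" "\<tau> \<in> {\<sigma>..\<sigma> + \<delta>}" for \<omega> \<tau>
      using that \<sigma> a
      by (intro continuous_intros continuous_on_subset[OF continuous_W_right[of \<omega>]]) auto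
    fix s t y assume s: "a \<le> s" "s < t" and y: "(y :: real) > 0"
    then have "0 \<le> s" using a by simp
    from rectangle_tail[OF \<sigma> \<delta> this s(2) y]
    show "fails_within M (8 * exp (- y\<^sup>2 / (256 * \<delta> * (t - s))))
       (\<lambda>\<omega>. \<forall>\<tau>\<in>{\<sigma>..\<sigma> + \<delta>}. \<bar>(W \<tau> t \<omega> - W \<sigma> t \<omega>) - (W \<tau> s \<omega> - W \<sigma> s \<omega>)\<bar> \<le> y)"
      by (simp add: algebra_simps)
  qed (use \<delta> x in auto)
  then show ?thesis by simp
qed

text \<open>This controls the path inside a grid cell. The denominator has 256 where a single
  increment has 2, a loss that a fine enough grid makes up for.\<close>

lemma increment_sup_tail:
  assumes \<sigma>: "0 < \<sigma>" and a: "0 \<le> a" and d: "d > 0" and x: "x > 0"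
  shows "fails_within M (8 * exp (- x\<^sup>2 / (256 * \<sigma> * d)))
    (\<lambda>\<omega>. \<forall>t\<in>{a..a + d}. \<bar>W \<sigma> t \<omega> - W \<sigma> a \<omega>\<bar> \<le> x)"
proof -
  have "fails_within M (4 * 2 * exp (- x\<^sup>2 / (128 * (2 * \<sigma>) * d)))
    (\<lambda>\<omega>. \<forall>t\<in>{a..a + d}. \<forall>_\<in>{()}. \<bar>W \<sigma> t \<omega> - W \<sigma> a \<omega>\<bar> \<le> x)"
  proof (rule chaining[where X = "\<lambda>t _ \<omega>. W \<sigma> t \<omega>", OF d])
    show "continuous_on {a..a + d} (\<lambda>t. W \<sigma> t \<omega>)" if "\<omega> \<in> space M" for \<omega>
      using that \<sigma> a by (intro continuous_on_subset[OF continuous_W_right[of \<omega>]]) auto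
    fix s t y assume s: "a \<le> s" "s < t" and y: "(y :: real) > 0"
    have "(\<lambda>\<omega>. W \<sigma> t \<omega> - W \<sigma> s \<omega>) \<in> lin_span"
      using a \<sigma> s by (intro lin_span_diff lin_span_W) auto
    from lin_span_tail[OF this cov_increment _ y]
    show "fails_within M (2 * exp (- y\<^sup>2 / (2 * \<sigma> * (t - s))))
       (\<lambda>\<omega>. \<forall>_\<in>{()}. \<bar>W \<sigma> t \<omega> - W \<sigma> s \<omega>\<bar> \<le> y)"
      using a \<sigma> s by (simp add: mult.assoc)
  qed (use \<sigma> x in auto)
  then show ?thesis by simp
qed

end

section \<open>Moduli of continuity\<close>

definition levy_scale :: "real \<Rightarrow> real" where
  "levy_scale \<epsilon> = sqrt (2 * \<epsilon> * ln (1 / \<epsilon>))"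

lemma levy_scale_pos: "0 < x \<Longrightarrow> x < 1 \<Longrightarrow> 0 < levy_scale x"
  by (simp add: levy_scale_def)

lemma levy_scale_nonneg: "0 < x \<Longrightarrow> x \<le> 1 \<Longrightarrow> 0 \<le> levy_scale x"
  by (simp add: levy_scale_def)

text \<open>\<open>levy_scale\<close> is not monotone on the unit interval, as it returns to 0 at 1,
  but its quotient by the square root is decreasing. This gives the comparison of two
  scales.\<close>

lemma levy_scale_le:
  assumes "0 < x" "x \<le> y" "y < 1"
  shows "levy_scale y \<le> sqrt (y / x) * levy_scale x"
proof -
  have "ln (1 / y) \<le> ln (1 / x)" using assms by (simp add: ln_div)
  then have "2 * y * ln (1 / y) \<le> 2 * y * ln (1 / x)" using assms by (intro mult_left_mono) auto
  also have "\<dots> = y / x * (2 * x * ln (1 / x))" using assms by simp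
  finally show ?thesis
    unfolding levy_scale_def real_sqrt_mult[symmetric] by (rule real_sqrt_le_mono)
qed

text \<open>Both neighbouring scales are provided, as upper bounds will use the coarser one and
  lower bounds the finer one. The condition \<open>k \<ge> 2\<close> keeps the coarser scale
  strictly below 1, where \<open>levy_scale\<close> is positive.\<close>

lemma eventually_power_scale:
  fixes p :: nat
  assumes p: "p > 0" and P: "\<forall>\<^sub>F k in sequentially. P k"
  shows "\<forall>\<^sub>F \<epsilon> in at_right (0::real). \<exists>k\<ge>2. P k \<and> P (Suc k) \<and> 1 / real (Suc k) ^ p \<le> \<epsilon> \<and> \<epsilon> \<le> 1 / real k ^ p"
proof -
  obtain K where K: "\<And>k. k \<ge> K \<Longrightarrow> P k" using P by (auto simp: eventually_sequentially)
  have "\<exists>k\<ge>2. P k \<and> P (Suc k) \<and> 1 / real (Suc k) ^ p \<le> \<epsilon> \<and> \<epsilon> \<le> 1 / real k ^ p"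
    if \<epsilon>: "0 < \<epsilon>" "\<epsilon> < 1 / real (K + 2) ^ p" for \<epsilon>
  proof -
    define r where "r = root p (1 / \<epsilon>)"
    define k where "k = nat \<lfloor>r\<rfloor>"
    have r: "r > 0" "r ^ p = 1 / \<epsilon>" using \<epsilon> p by (simp_all add: r_def)
    have "real (K + 2) ^ p < 1 / \<epsilon>" using \<epsilon> by (simp add: field_simps)
    then have "real (K + 2) < r" using r by (metis less_eq_real_def power_less_imp_less_base)
    then have k: "k \<ge> K + 2" by (simp add: k_def le_nat_floor)
    have "real k \<le> r" using r by (simp add: k_def)
    then have "real k ^ p \<le> 1 / \<epsilon>" unfolding r(2)[symmetric] by (intro power_mono) auto
    moreover have "r \<le> real (Suc k)" unfolding k_def using r(1) by linarith
    then have "1 / \<epsilon> \<le> real (Suc k) ^ p" unfolding r(2)[symmetric] using r(1) by (intro power_mono) auto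
    moreover have "real k ^ p > 0" "real (Suc k) ^ p > 0" using k by simp_all
    ultimately show ?thesis using k K[of k] K[of "Suc k"] \<epsilon>
      by (intro exI[of _ k]) (auto simp: field_simps simp del: of_nat_Suc)
  qed
  then show ?thesis
    unfolding eventually_at_right_field by (intro exI[of _ "1 / real (K + 2) ^ p"]) auto
qed

lemma power_ratio_tendsto: "(\<lambda>k. C * sqrt ((real (Suc k) / real k) ^ p)) \<longlonglongrightarrow> C"
proof -
  have "(\<lambda>k. C * sqrt ((real (Suc k) / real k) ^ p)) \<longlonglongrightarrow> C * sqrt (1 ^ p)"
    by (intro tendsto_intros LIMSEQ_Suc_n_over_n)
  then show ?thesis by simp
qed

lemma levy_scale_power_bounds:
  assumes p: "p > 0" and k: "k \<ge> 2" and \<epsilon>: "1 / real (Suc k) ^ p \<le> \<epsilon>" "\<epsilon> \<le> 1 / real k ^ p"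
  shows "levy_scale (1 / real k ^ p) \<le> sqrt ((real (Suc k) / real k) ^ p) * levy_scale \<epsilon>"
    and "levy_scale \<epsilon> \<le> sqrt ((real (Suc k) / real k) ^ p) * levy_scale (1 / real (Suc k) ^ p)"
    and "0 < \<epsilon>" "\<epsilon> < 1"
proof -
  have pos: "0 < 1 / real (Suc k) ^ p" by simp
  then show \<epsilon>0: "0 < \<epsilon>" using \<epsilon> by linarith
  have k1: "1 < real k ^ p" using k p by (intro one_less_power) auto
  then have l1: "1 / real k ^ p < 1" using k by (simp add: divide_less_eq_1)
  then show \<epsilon>1: "\<epsilon> < 1" using \<epsilon> by linarith
  have q: "(1 / real k ^ p) / (1 / real (Suc k) ^ p) = (real (Suc k) / real k) ^ p"
    by (simp add: power_divide)
  have "levy_scale (1 / real k ^ p) \<le> sqrt ((1 / real k ^ p) / \<epsilon>) * levy_scale \<epsilon>"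
    using \<epsilon>0 \<epsilon> l1 by (intro levy_scale_le)
  also have "(1 / real k ^ p) / \<epsilon> \<le> (1 / real k ^ p) / (1 / real (Suc k) ^ p)"
    using pos \<epsilon> \<epsilon>0 k1 by (intro divide_left_mono mult_pos_pos) auto
  finally show "levy_scale (1 / real k ^ p) \<le> sqrt ((real (Suc k) / real k) ^ p) * levy_scale \<epsilon>"
    unfolding q using levy_scale_nonneg[of \<epsilon>] \<epsilon>0 \<epsilon>1 by (simp add: mult_right_mono)
  have "levy_scale \<epsilon> \<le> sqrt (\<epsilon> / (1 / real (Suc k) ^ p)) * levy_scale (1 / real (Suc k) ^ p)"
    using \<epsilon>1 \<epsilon> pos by (intro levy_scale_le)
  also have "\<epsilon> / (1 / real (Suc k) ^ p) \<le> (1 / real k ^ p) / (1 / real (Suc k) ^ p)"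
    using pos \<epsilon> by (intro divide_right_mono) auto
  finally show "levy_scale \<epsilon> \<le> sqrt ((real (Suc k) / real k) ^ p) * levy_scale (1 / real (Suc k) ^ p)"
    unfolding q using levy_scale_nonneg[OF pos] \<epsilon> \<epsilon>1 by (simp add: mult_right_mono)
qed

text \<open>Pairs within \<open>\<epsilon>\<close> are also within the next coarser scale
  \<open>1 / k ^ p\<close>. The ratio of the two values of \<open>levy_scale\<close> is at most a
  quantity tending to 1, and the gap between \<open>C\<close> and \<open>C'\<close> absorbs
  it.\<close>

lemma upper_bound_of_power_scale:
  assumes p: "p > 0" and C: "0 \<le> C" "C < C'"
    and ev: "\<forall>\<^sub>F k in sequentially. \<forall>u\<in>U. \<forall>v\<in>U. \<bar>u - v\<bar> \<le> 1 / real k ^ p \<longrightarrow> F u v \<le> C * levy_scale (1 / real k ^ p)"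
  shows "\<forall>\<^sub>F \<epsilon> in at_right 0. \<forall>u\<in>U. \<forall>v\<in>U. \<bar>u - v\<bar> \<le> \<epsilon> \<longrightarrow> F u v \<le> C' * levy_scale \<epsilon>"
proof -
  have "\<forall>\<^sub>F k in sequentially. C * sqrt ((real (Suc k) / real k) ^ p) < C'"
    by (rule order_tendstoD[OF power_ratio_tendsto C(2)])
  from eventually_power_scale[OF p eventually_conj[OF ev this]] show ?thesis
  proof eventually_elim
    case (elim \<epsilon>)
    then obtain k where k: "k \<ge> 2" "1 / real (Suc k) ^ p \<le> \<epsilon>" "\<epsilon> \<le> 1 / real k ^ p"
      and F: "\<And>u v. u \<in> U \<Longrightarrow> v \<in> U \<Longrightarrow> \<bar>u - v\<bar> \<le> 1 / real k ^ p \<Longrightarrow> F u v \<le> C * levy_scale (1 / real k ^ p)"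
      and r: "C * sqrt ((real (Suc k) / real k) ^ p) < C'"
      by blast
    note b = levy_scale_power_bounds[OF p k]
    have "C * levy_scale (1 / real k ^ p) \<le> C * (sqrt ((real (Suc k) / real k) ^ p) * levy_scale \<epsilon>)"
      using b C by (intro mult_left_mono) auto
    also have "\<dots> \<le> C' * levy_scale \<epsilon>"
      unfolding mult.assoc[symmetric] using r levy_scale_nonneg[of \<epsilon>] b by (intro mult_right_mono) auto
    finally show ?case using F k(3) by fastforce
  qed
qed

text \<open>Here the next finer scale \<open>1 / Suc k ^ p\<close> is used: a pair that witnesses
  the bound at that scale is also admissible for \<open>\<epsilon>\<close>.\<close>

lemma lower_bound_of_power_scale:
  assumes p: "p > 0" and C: "0 \<le> C'" "C' < C"
    and ev: "\<forall>\<^sub>F k in sequentially. \<exists>u\<in>U. \<exists>v\<in>U. \<bar>u - v\<bar> \<le> 1 / real k ^ p \<and> C * levy_scale (1 / real k ^ p) \<le> F u v"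
  shows "\<forall>\<^sub>F \<epsilon> in at_right 0. \<exists>u\<in>U. \<exists>v\<in>U. \<bar>u - v\<bar> \<le> \<epsilon> \<and> C' * levy_scale \<epsilon> \<le> F u v"
proof -
  have "\<forall>\<^sub>F k in sequentially. C' * sqrt ((real (Suc k) / real k) ^ p) < C"
    by (rule order_tendstoD[OF power_ratio_tendsto C(2)])
  from eventually_power_scale[OF p eventually_conj[OF ev this]] show ?thesis
  proof eventually_elim
    case (elim \<epsilon>)
    then obtain k where k: "k \<ge> 2" "1 / real (Suc k) ^ p \<le> \<epsilon>" "\<epsilon> \<le> 1 / real k ^ p"
      and F: "\<exists>u\<in>U. \<exists>v\<in>U. \<bar>u - v\<bar> \<le> 1 / real (Suc k) ^ p \<and> C * levy_scale (1 / real (Suc k) ^ p) \<le> F u v"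
      and r: "C' * sqrt ((real (Suc k) / real k) ^ p) < C"
      by blast
    note b = levy_scale_power_bounds[OF p k]
    have "C' * levy_scale \<epsilon> \<le> C' * (sqrt ((real (Suc k) / real k) ^ p) * levy_scale (1 / real (Suc k) ^ p))"
      using b C by (intro mult_left_mono) auto
    also have "\<dots> \<le> C * levy_scale (1 / real (Suc k) ^ p)"
      unfolding mult.assoc[symmetric]
      using r levy_scale_nonneg[of "1 / real (Suc k) ^ p"] b k(2)
      by (intro mult_right_mono) auto
    finally show ?case using F k(2) by (meson order_trans)
  qed
qed

text \<open>Go from \<open>u\<close> down to its grid point, across to the grid point of
  \<open>v\<close>, and up to \<open>v\<close>: two cells and one grid pair. As \<open>u\<close> and
  \<open>v\<close> are at most \<open>K / N\<close> apart, rounding down separates the grid points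
  by at most \<open>K\<close> steps. The index \<open>i = N\<close> is included because the point 1
  rounds down to itself.\<close>

lemma grid_bound:
  fixes R :: "real \<Rightarrow> real" and N K :: nat
  assumes N: "N > 0" and y: "y \<ge> 0"
    and cell: "\<And>i t. i \<le> N \<Longrightarrow> t \<in> {real i / N..real i / N + 1 / N} \<Longrightarrow> \<bar>R t - R (real i / N)\<bar> \<le> x"
    and pair: "\<And>i l. i \<le> N \<Longrightarrow> l \<in> {1..K} \<Longrightarrow> \<bar>R (real (i + l) / N) - R (real i / N)\<bar> \<le> y"
    and uv: "u \<in> {0..1}" "v \<in> {0..1}" "\<bar>u - v\<bar> \<le> K / N"
  shows "\<bar>R u - R v\<bar> \<le> y + 2 * x"
proof -
  have ord: "\<bar>R u - R v\<bar> \<le> y + 2 * x" if uv: "u \<in> {0..1}" "v \<in> {0..1}" "u \<le> v" "v - u \<le> K / N" for u v :: real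
  proof -
    have cellof: "real (nat \<lfloor>t * N\<rfloor>) \<le> t * N \<and> t * N < real (nat \<lfloor>t * N\<rfloor>) + 1 \<and> nat \<lfloor>t * N\<rfloor> \<le> N
        \<and> \<bar>R t - R (real (nat \<lfloor>t * N\<rfloor>) / N)\<bar> \<le> x" if t: "t \<in> {0..1}" for t :: real
    proof -
      have tN: "0 \<le> t * N" "t * N \<le> N" using t N by (auto simp: mult_left_le_one_le)
      let ?i = "nat \<lfloor>t * N\<rfloor>"
      have i: "real ?i \<le> t * N" "t * N < real ?i + 1" using tN by linarith+
      then have iN: "?i \<le> N" using tN by linarith
      have "real ?i / N \<le> t" "t \<le> real ?i / N + 1 / N" using i N by (auto simp: field_simps)
      with cell[OF iN] i iN show ?thesis by auto
    qed
    define i j where "i = nat \<lfloor>u * N\<rfloor>" and "j = nat \<lfloor>v * N\<rfloor>"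
    note I = cellof[OF uv(1), folded i_def] and J = cellof[OF uv(2), folded j_def]
    have "u * N \<le> v * N" using uv N by simp
    then have "i \<le> j" unfolding i_def j_def by (intro nat_mono floor_mono)
    have "(v - u) * N \<le> K" using uv N by (simp add: field_simps)
    then have "real j < real i + 1 + real K" using I J by (simp add: algebra_simps)
    then have "j \<le> i + K" by linarith
    have "\<bar>R (real j / N) - R (real i / N)\<bar> \<le> y"
    proof (cases "i = j")
      case False
      then show ?thesis using pair[of i "j - i"] I \<open>i \<le> j\<close> \<open>j \<le> i + K\<close> by (auto simp: Suc_le_eq)
    qed (use y in simp)
    with I J show ?thesis by linarith
  qed
  show ?thesis
  proof (cases "u \<le> v")
    case True
    then show ?thesis using ord[of u v] uv by auto
  next
    case False
    then show ?thesis using ord[of v u] uv by auto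
  qed
qed

text \<open>Levy's modulus with constant \<open>c\<close>, with the supremum split into an upper
  bound for all pairs and a lower bound for some pair. The two halves are proved on different
  events, and boundedness of the supremum becomes an issue only in
  \<open>levy_modulus_tendsto\<close>. A general \<open>c\<close> is needed for
  \<open>W \<sigma>\<close>, whose constant is \<open>sqrt \<sigma>\<close>.\<close>

definition levy_modulus :: "real \<Rightarrow> (real \<Rightarrow> real) \<Rightarrow> bool" where
  "levy_modulus c f \<longleftrightarrow> (\<forall>\<theta>>0.
     (\<forall>\<^sub>F \<epsilon> in at_right 0. \<forall>u\<in>{0..1}. \<forall>v\<in>{0..1}. \<bar>u - v\<bar> \<le> \<epsilon> \<longrightarrow> \<bar>f u - f v\<bar> \<le> (c + \<theta>) * levy_scale \<epsilon>) \<and>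
     (\<forall>\<^sub>F \<epsilon> in at_right 0. \<exists>u\<in>{0..1}. \<exists>v\<in>{0..1}. \<bar>u - v\<bar> \<le> \<epsilon> \<and> (c - \<theta>) * levy_scale \<epsilon> \<le> \<bar>f u - f v\<bar>))"

lemma eventually_at_right_unit: "\<forall>\<^sub>F \<epsilon> in at_right (0::real). 0 < \<epsilon> \<and> \<epsilon> < 1"
  unfolding eventually_at_right_field by (intro exI[of _ 1]) auto

lemma levy_modulus_scale:
  assumes f: "levy_modulus c f" and a: "a > 0"
  shows "levy_modulus (a * c) (\<lambda>t. a * f t)"
  unfolding levy_modulus_def
proof (intro allI impI conjI)
  fix \<theta> :: real assume "\<theta> > 0"
  then have \<theta>: "\<theta> / a > 0" using a by simp
  have a1: "a * (c + \<theta> / a) = a * c + \<theta>" "a * (c - \<theta> / a) = a * c - \<theta>"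
    using a by (simp_all add: algebra_simps)
  have a2: "\<bar>a * x - a * y\<bar> = a * \<bar>x - y\<bar>" for x y
    using a by (simp add: right_diff_distrib[symmetric] abs_mult)
  have a3: "a * \<bar>x\<bar> \<le> (a * c + \<theta>) * h \<longleftrightarrow> \<bar>x\<bar> \<le> (c + \<theta> / a) * h"
       "(a * c - \<theta>) * h \<le> a * \<bar>x\<bar> \<longleftrightarrow> (c - \<theta> / a) * h \<le> \<bar>x\<bar>" for x h
    unfolding a1[symmetric] mult.assoc using a by simp_all
  show "\<forall>\<^sub>F \<epsilon> in at_right 0. \<forall>u\<in>{0..1}. \<forall>v\<in>{0..1}. \<bar>u - v\<bar> \<le> \<epsilon> \<longrightarrow> \<bar>a * f u - a * f v\<bar> \<le> (a * c + \<theta>) * levy_scale \<epsilon>"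
    unfolding a2 a3 using f \<theta> by (simp add: levy_modulus_def)
  show "\<forall>\<^sub>F \<epsilon> in at_right 0. \<exists>u\<in>{0..1}. \<exists>v\<in>{0..1}. \<bar>u - v\<bar> \<le> \<epsilon> \<and> (a * c - \<theta>) * levy_scale \<epsilon> \<le> \<bar>a * f u - a * f v\<bar>"
    unfolding a2 a3 using f \<theta> by (simp add: levy_modulus_def)
qed

text \<open>Closedness of the property under approximation in the modulus itself. Closeness in the
  uniform norm would say nothing about increments at small scales.\<close>

lemma levy_modulus_approx:
  assumes "\<And>\<eta>. \<eta> > 0 \<Longrightarrow> \<exists>c' g. levy_modulus c' g \<and> \<bar>c - c'\<bar> \<le> \<eta> \<and>
    (\<forall>\<^sub>F \<epsilon> in at_right 0. \<forall>u\<in>{0..1}. \<forall>v\<in>{0..1}. \<bar>u - v\<bar> \<le> \<epsilon> \<longrightarrow> \<bar>(f u - f v) - (g u - g v)\<bar> \<le> \<eta> * levy_scale \<epsilon>)"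
  shows "levy_modulus c f"
  unfolding levy_modulus_def
proof (intro allI impI)
  fix \<theta> :: real assume "\<theta> > 0"
  \<comment> \<open>One third each for the error in the constant, the slack in the modulus of
    \<open>g\<close>, and the modulus of \<open>f - g\<close>.\<close>
  then have \<theta>: "\<theta> / 3 > 0" by simp
  obtain c' g where g: "levy_modulus c' g" and c': "\<bar>c - c'\<bar> \<le> \<theta> / 3"
    and fg: "\<forall>\<^sub>F \<epsilon> in at_right 0. \<forall>u\<in>{0..1}. \<forall>v\<in>{0..1}. \<bar>u - v\<bar> \<le> \<epsilon> \<longrightarrow> \<bar>(f u - f v) - (g u - g v)\<bar> \<le> \<theta> / 3 * levy_scale \<epsilon>"
    using assms[OF \<theta>] by blast
  have h: "(c' + \<theta> / 3) * levy_scale \<epsilon> + \<theta> / 3 * levy_scale \<epsilon> \<le> (c + \<theta>) * levy_scale \<epsilon>"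
    "(c - \<theta>) * levy_scale \<epsilon> \<le> (c' - \<theta> / 3) * levy_scale \<epsilon> - \<theta> / 3 * levy_scale \<epsilon>" if "0 < \<epsilon> \<and> \<epsilon> < 1" for \<epsilon>
  proof -
    have "0 \<le> levy_scale \<epsilon>" using that by (simp add: levy_scale_nonneg)
    then show "(c' + \<theta> / 3) * levy_scale \<epsilon> + \<theta> / 3 * levy_scale \<epsilon> \<le> (c + \<theta>) * levy_scale \<epsilon>"
      "(c - \<theta>) * levy_scale \<epsilon> \<le> (c' - \<theta> / 3) * levy_scale \<epsilon> - \<theta> / 3 * levy_scale \<epsilon>"
      using c' unfolding distrib_right[symmetric] left_diff_distrib[symmetric]
      by (intro mult_right_mono; linarith)+
  qed
  have g1: "\<forall>\<^sub>F \<epsilon> in at_right 0. \<forall>u\<in>{0..1}. \<forall>v\<in>{0..1}. \<bar>u - v\<bar> \<le> \<epsilon> \<longrightarrow> \<bar>g u - g v\<bar> \<le> (c' + \<theta> / 3) * levy_scale \<epsilon>"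
    and g2: "\<forall>\<^sub>F \<epsilon> in at_right 0. \<exists>u\<in>{0..1}. \<exists>v\<in>{0..1}. \<bar>u - v\<bar> \<le> \<epsilon> \<and> (c' - \<theta> / 3) * levy_scale \<epsilon> \<le> \<bar>g u - g v\<bar>"
    using g \<theta> by (auto simp: levy_modulus_def)
  show "(\<forall>\<^sub>F \<epsilon> in at_right 0. \<forall>u\<in>{0..1}. \<forall>v\<in>{0..1}. \<bar>u - v\<bar> \<le> \<epsilon> \<longrightarrow> \<bar>f u - f v\<bar> \<le> (c + \<theta>) * levy_scale \<epsilon>) \<and>
     (\<forall>\<^sub>F \<epsilon> in at_right 0. \<exists>u\<in>{0..1}. \<exists>v\<in>{0..1}. \<bar>u - v\<bar> \<le> \<epsilon> \<and> (c - \<theta>) * levy_scale \<epsilon> \<le> \<bar>f u - f v\<bar>)"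
  proof
    show "\<forall>\<^sub>F \<epsilon> in at_right 0. \<forall>u\<in>{0..1}. \<forall>v\<in>{0..1}. \<bar>u - v\<bar> \<le> \<epsilon> \<longrightarrow> \<bar>f u - f v\<bar> \<le> (c + \<theta>) * levy_scale \<epsilon>"
      using g1 fg eventually_at_right_unit
    proof eventually_elim
      case (elim \<epsilon>)
      show ?case
      proof (intro ballI impI)
        fix u v :: real assume uv: "u \<in> {0..1}" "v \<in> {0..1}" "\<bar>u - v\<bar> \<le> \<epsilon>"
        have "\<bar>g u - g v\<bar> \<le> (c' + \<theta> / 3) * levy_scale \<epsilon>" "\<bar>(f u - f v) - (g u - g v)\<bar> \<le> \<theta> / 3 * levy_scale \<epsilon>"
          using elim uv by blast+
        then show "\<bar>f u - f v\<bar> \<le> (c + \<theta>) * levy_scale \<epsilon>" using h(1)[OF elim(3)] by linarith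
      qed
    qed
    show "\<forall>\<^sub>F \<epsilon> in at_right 0. \<exists>u\<in>{0..1}. \<exists>v\<in>{0..1}. \<bar>u - v\<bar> \<le> \<epsilon> \<and> (c - \<theta>) * levy_scale \<epsilon> \<le> \<bar>f u - f v\<bar>"
      using g2 fg eventually_at_right_unit
    proof eventually_elim
      case (elim \<epsilon>)
      then obtain u v where uv: "u \<in> {0..1}" "v \<in> {0..1}" "\<bar>u - v\<bar> \<le> \<epsilon>"
        and *: "(c' - \<theta> / 3) * levy_scale \<epsilon> \<le> \<bar>g u - g v\<bar>" by blast
      have "\<bar>(f u - f v) - (g u - g v)\<bar> \<le> \<theta> / 3 * levy_scale \<epsilon>" using elim uv by blast
      then have "(c - \<theta>) * levy_scale \<epsilon> \<le> \<bar>f u - f v\<bar>" using * h(2)[OF elim(3)] by linarith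
      with uv show ?case by blast
    qed
  qed
qed

lemma levy_modulus_tendsto:
  assumes "levy_modulus c f"
  shows "((\<lambda>\<epsilon>. SUP (u, v) \<in> {(u, v). u \<in> {0..1} \<and> v \<in> {0..1} \<and> \<bar>u - v\<bar> \<le> \<epsilon>}.
               \<bar>f u - f v\<bar> / sqrt (2 * \<epsilon> * ln (1 / \<epsilon>))) \<longlongrightarrow> c) (at_right 0)"
proof (rule tendstoI)
  fix e :: real assume e: "e > 0"
  then have e2: "e / 2 > 0" by simp
  have ev: "\<forall>\<^sub>F \<epsilon> in at_right 0. \<forall>u\<in>{0..1}. \<forall>v\<in>{0..1}. \<bar>u - v\<bar> \<le> \<epsilon> \<longrightarrow> \<bar>f u - f v\<bar> \<le> (c + e / 2) * levy_scale \<epsilon>"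
     "\<forall>\<^sub>F \<epsilon> in at_right 0. \<exists>u\<in>{0..1}. \<exists>v\<in>{0..1}. \<bar>u - v\<bar> \<le> \<epsilon> \<and> (c - e / 2) * levy_scale \<epsilon> \<le> \<bar>f u - f v\<bar>"
    using assms e2 by (auto simp: levy_modulus_def)
  show "\<forall>\<^sub>F \<epsilon> in at_right 0. dist (SUP (u, v) \<in> {(u, v). u \<in> {0..1} \<and> v \<in> {0..1} \<and> \<bar>u - v\<bar> \<le> \<epsilon>}.
               \<bar>f u - f v\<bar> / sqrt (2 * \<epsilon> * ln (1 / \<epsilon>))) c < e"
    using ev eventually_at_right_unit
  proof eventually_elim
    case (elim \<epsilon>)
    let ?D = "{(u, v). u \<in> {0..1 :: real} \<and> v \<in> {0..1} \<and> \<bar>u - v\<bar> \<le> \<epsilon>}"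
    let ?F = "\<lambda>(u, v). \<bar>f u - f v\<bar> / levy_scale \<epsilon>"
    have h: "levy_scale \<epsilon> > 0" using elim by (simp add: levy_scale_pos)
    have le: "?F w \<le> c + e / 2" if "w \<in> ?D" for w
      using elim(1) that h by (auto simp: divide_le_eq)
    obtain u v where uv: "(u, v) \<in> ?D" and *: "(c - e / 2) * levy_scale \<epsilon> \<le> \<bar>f u - f v\<bar>"
      using elim(2) by blast
    have "(SUP w\<in>?D. ?F w) \<le> c + e / 2"
      using uv le by (intro cSUP_least) auto
    moreover have "?F (u, v) \<le> (SUP w\<in>?D. ?F w)"
      using uv le by (intro cSUP_upper bdd_aboveI2) auto
    moreover have "c - e / 2 \<le> ?F (u, v)" using * h by (simp add: le_divide_eq)
    ultimately have "\<bar>(SUP w\<in>?D. ?F w) - c\<bar> \<le> e / 2" by linarith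
    then have "dist (SUP w\<in>?D. ?F w) c < e" using e by (simp add: dist_real_def)
    then show ?case by (simp add: levy_scale_def)
  qed
qed

section \<open>Increments at a fixed parameter and fluctuations\<close>

lemma levy_scale_inverse_square:
  assumes "n \<ge> 1"
  shows "(levy_scale (1 / n))\<^sup>2 = 2 * ln n / n"
  using assms by (simp add: levy_scale_def)

context sheet
begin

text \<open>No sharp constant is at stake here: whatever chaining loses is bought back by shrinking
  \<open>\<delta>\<close>, which divides the exponent. Even the scales \<open>1 / k\<close> then
  have summable failure probabilities.\<close>

lemma fluctuation:
  assumes \<eta>: "\<eta> > 0"
  shows "\<exists>\<delta>>0. \<forall>\<sigma>\<ge>0. AE \<omega> in M. \<forall>\<^sub>F k in sequentially. \<forall>\<tau>\<in>{\<sigma>..\<sigma> + \<delta>}. \<forall>u\<in>{0..1}. \<forall>v\<in>{0..1}.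
    \<bar>u - v\<bar> \<le> 1 / real k \<longrightarrow>
    \<bar>(W \<tau> u \<omega> - W \<tau> v \<omega>) - (W \<sigma> u \<omega> - W \<sigma> v \<omega>)\<bar> \<le> \<eta> * levy_scale (1 / real k)"
proof -
  \<comment> \<open>chosen so that the tail bound of a cell of length \<open>1 / k\<close> is exactly \<open>32 / k ^ 3\<close>\<close>
  define \<delta> where "\<delta> = \<eta>\<^sup>2 / 442368"
  have \<delta>: "\<delta> > 0" using \<eta> by (simp add: \<delta>_def)
  have "AE \<omega> in M. \<forall>\<^sub>F k in sequentially. \<forall>\<tau>\<in>{\<sigma>..\<sigma> + \<delta>}. \<forall>u\<in>{0..1}. \<forall>v\<in>{0..1}.
    \<bar>u - v\<bar> \<le> 1 / real k \<longrightarrow>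
    \<bar>(W \<tau> u \<omega> - W \<tau> v \<omega>) - (W \<sigma> u \<omega> - W \<sigma> v \<omega>)\<bar> \<le> \<eta> * levy_scale (1 / real k)" if \<sigma>: "\<sigma> \<ge> 0" for \<sigma>
  proof (rule fails_within_eventually)
    show "summable (\<lambda>k. 64 * (1 / real k ^ 2))"
      by (intro summable_mult) (use inverse_power_summable[of 2] in \<open>simp add: field_simps\<close>)
    show "\<forall>\<^sub>F k in sequentially. fails_within M (64 * (1 / real k ^ 2))
      (\<lambda>\<omega>. \<forall>\<tau>\<in>{\<sigma>..\<sigma> + \<delta>}. \<forall>u\<in>{0..1}. \<forall>v\<in>{0..1}. \<bar>u - v\<bar> \<le> 1 / real k \<longrightarrow>
        \<bar>(W \<tau> u \<omega> - W \<tau> v \<omega>) - (W \<sigma> u \<omega> - W \<sigma> v \<omega>)\<bar> \<le> \<eta> * levy_scale (1 / real k))"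
      using eventually_ge_at_top[of 2]
    proof eventually_elim
      case (elim k)
      then have k: "real k \<ge> 2" by simp
      \<comment> \<open>A third of the target, because \<open>grid_bound\<close> with equal cell and
        pair bounds gives \<open>x + 2 * x\<close>.\<close>
      define x where "x = \<eta> / 3 * levy_scale (1 / real k)"
      have x: "x > 0" using \<eta> k by (simp add: x_def levy_scale_pos)
      have "fails_within M (64 * (1 / real k ^ 2))
        (\<lambda>\<omega>. \<forall>i\<in>{..k}. \<forall>t\<in>{real i / k..real i / k + 1 / k}. \<forall>\<tau>\<in>{\<sigma>..\<sigma> + \<delta>}.
            \<bar>(W \<tau> t \<omega> - W \<sigma> t \<omega>) - (W \<tau> (real i / k) \<omega> - W \<sigma> (real i / k) \<omega>)\<bar> \<le> x)"
      proof (rule fails_within_ball)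
        show "fails_within M (32 * exp (- x\<^sup>2 / (32768 * \<delta> * (1 / k))))
          (\<lambda>\<omega>. \<forall>t\<in>{real i / k..real i / k + 1 / k}. \<forall>\<tau>\<in>{\<sigma>..\<sigma> + \<delta>}.
            \<bar>(W \<tau> t \<omega> - W \<sigma> t \<omega>) - (W \<tau> (real i / k) \<omega> - W \<sigma> (real i / k) \<omega>)\<bar> \<le> x)" for i
          using \<sigma> \<delta> x k by (intro rectangle_sup_tail) auto
        have "x\<^sup>2 / (32768 * \<delta> * (1 / k)) = 3 * ln k"
          using k \<eta> by (simp add: x_def power_mult_distrib levy_scale_inverse_square \<delta>_def power_divide field_simps)
        then have "exp (- x\<^sup>2 / (32768 * \<delta> * (1 / k))) = exp (- (3 * ln k))" by simp
        also have "\<dots> = real k powr (- 3)" using k by (simp add: powr_def)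
        also have "\<dots> = 1 / real k ^ 3" using k by (simp add: powr_minus powr_numeral inverse_eq_divide)
        finally have e: "exp (- x\<^sup>2 / (32768 * \<delta> * (1 / k))) = 1 / real k ^ 3" .
        have "real (card {..k}) \<le> 2 * real k" using k by simp
        then have "real (card {..k}) * (32 * (1 / real k ^ 3)) \<le> (2 * real k) * (32 * (1 / real k ^ 3))"
          by (intro mult_right_mono) auto
        also have "\<dots> = 64 * (1 / real k ^ 2)" using k by (simp add: power2_eq_square power3_eq_cube)
        finally show "real (card {..k}) * (32 * exp (- x\<^sup>2 / (32768 * \<delta> * (1 / k)))) \<le> 64 * (1 / real k ^ 2)"
          unfolding e .
      qed simp
      then show ?case
      proof (rule fails_within_mono)
        fix \<omega>
        assume cell: "\<forall>i\<in>{..k}. \<forall>t\<in>{real i / k..real i / k + 1 / k}. \<forall>\<tau>\<in>{\<sigma>..\<sigma> + \<delta>}.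
            \<bar>(W \<tau> t \<omega> - W \<sigma> t \<omega>) - (W \<tau> (real i / k) \<omega> - W \<sigma> (real i / k) \<omega>)\<bar> \<le> x"
        show "\<forall>\<tau>\<in>{\<sigma>..\<sigma> + \<delta>}. \<forall>u\<in>{0..1}. \<forall>v\<in>{0..1}. \<bar>u - v\<bar> \<le> 1 / real k \<longrightarrow>
          \<bar>(W \<tau> u \<omega> - W \<tau> v \<omega>) - (W \<sigma> u \<omega> - W \<sigma> v \<omega>)\<bar> \<le> \<eta> * levy_scale (1 / real k)"
        proof (intro ballI impI)
          fix \<tau> u v :: real assume \<tau>: "\<tau> \<in> {\<sigma>..\<sigma> + \<delta>}" and uv: "u \<in> {0..1}" "v \<in> {0..1}" "\<bar>u - v\<bar> \<le> 1 / real k"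
          have "\<bar>(\<lambda>t. W \<tau> t \<omega> - W \<sigma> t \<omega>) u - (\<lambda>t. W \<tau> t \<omega> - W \<sigma> t \<omega>) v\<bar> \<le> x + 2 * x"
          proof (rule grid_bound[where N = k and K = 1 and R = "\<lambda>t. W \<tau> t \<omega> - W \<sigma> t \<omega>"])
            \<comment> \<open>With \<open>K = 1\<close> the only grid pairs are the two ends of one
              cell, so the cell bound serves as the pair bound too.\<close>
            fix i l :: nat assume "i \<le> k" "l \<in> {1..1}"
            moreover have "real (i + 1) / k \<in> {real i / k..real i / k + 1 / k}" by (simp add: add_divide_distrib)
            ultimately show "\<bar>(\<lambda>t. W \<tau> t \<omega> - W \<sigma> t \<omega>) (real (i + l) / k) - (\<lambda>t. W \<tau> t \<omega> - W \<sigma> t \<omega>) (real i / k)\<bar> \<le> x"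
              using cell \<tau> by auto
          qed (use cell \<tau> uv k x in auto)
          moreover have "x + 2 * x = \<eta> * levy_scale (1 / real k)" by (simp add: x_def)
          ultimately show "\<bar>(W \<tau> u \<omega> - W \<tau> v \<omega>) - (W \<sigma> u \<omega> - W \<sigma> v \<omega>)\<bar> \<le> \<eta> * levy_scale (1 / real k)"
            by (simp add: algebra_simps)
        qed
      qed simp
    qed
  qed
  with \<delta> show ?thesis by blast
qed

section \<open>The sharp upper bound at a fixed parameter\<close>

lemma power_powr_le:
  assumes k: "real k \<ge> 1" and "p * \<theta> \<ge> 2"
  shows "(real k ^ p) powr (- \<theta>) \<le> 1 / real k ^ 2"
proof -
  have "(real k ^ p) powr (- \<theta>) = real k powr (- (p * \<theta>))"
    using k by (simp add: powr_realpow[symmetric] powr_powr)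
  also have "\<dots> \<le> real k powr (- 2)" using assms by (intro powr_mono) auto
  also have "\<dots> = 1 / real k ^ 2" using k by (simp add: powr_minus powr_numeral inverse_eq_divide)
  finally show ?thesis .
qed

text \<open>At scale \<open>1 / n\<close> the grid has mesh \<open>1 / (K * n)\<close>. Grid pairs
  at distance up to \<open>1 / n\<close> are estimated one by one with the exact Gaussian tail and
  yield the factor \<open>1 + \<theta>\<close>; the two cells at the ends, handled by chaining, add
  \<open>2 * \<theta>\<close>.\<close>

lemma increments_upper:
  assumes \<sigma>: "\<sigma> > 0" and \<theta>: "0 < \<theta>" "\<theta> \<le> 1"
  shows "\<exists>p>0. AE \<omega> in M. \<forall>\<^sub>F k in sequentially. \<forall>u\<in>{0..1}. \<forall>v\<in>{0..1}. \<bar>u - v\<bar> \<le> 1 / real k ^ p \<longrightarrow>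
    \<bar>W \<sigma> u \<omega> - W \<sigma> v \<omega>\<bar> \<le> (1 + 3 * \<theta>) * sqrt \<sigma> * levy_scale (1 / real k ^ p)"
proof -
  \<comment> \<open>The exponent for a cell is \<open>\<theta>^2 * K / 128 * ln n\<close>. As 384 =
    3 * 128, it is at least \<open>3 * ln n\<close>, hence at least
    \<open>(1 + 2 * \<theta>) * ln n\<close> because \<open>\<theta> \<le> 1\<close>.\<close>
  obtain K :: nat where K: "real K \<ge> 384 / \<theta>\<^sup>2" using real_arch_simple by blast
  have K0: "real K > 0" using K \<theta> by (smt (verit) divide_pos_pos zero_less_power)
  then have K1: "real K \<ge> 1" by simp
  have K2: "\<theta>\<^sup>2 * K \<ge> 384" using K \<theta> by (simp add: field_simps)
  \<comment> \<open>The union bound leaves a constant times \<open>n powr (- 2 * \<theta>)\<close>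
    with \<open>n = k ^ p\<close>; this \<open>p\<close> brings it below a constant times
    \<open>1 / k ^ 2\<close>.\<close>
  obtain p :: nat where p: "real p \<ge> 1 / \<theta>" using real_arch_simple by blast
  have p0: "p > 0" using p \<theta> by (smt (verit) divide_pos_pos of_nat_0_less_iff)
  have p2: "p * (2 * \<theta>) \<ge> 2" using p \<theta> by (simp add: field_simps)
  \<comment> \<open>The first summand counts the at most \<open>2 * K * n\<close> cells with tail
    factor 8, the second the at most \<open>2 * K * K * n\<close> grid pairs with tail factor
    2.\<close>
  define C where "C = 16 * real K + 4 * real K * real K"
  have "AE \<omega> in M. \<forall>\<^sub>F k in sequentially. \<forall>u\<in>{0..1}. \<forall>v\<in>{0..1}. \<bar>u - v\<bar> \<le> 1 / real k ^ p \<longrightarrow>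
    \<bar>W \<sigma> u \<omega> - W \<sigma> v \<omega>\<bar> \<le> (1 + 3 * \<theta>) * sqrt \<sigma> * levy_scale (1 / real k ^ p)"
  proof (rule fails_within_eventually)
    show "summable (\<lambda>k. C * (1 / real k ^ 2))"
      by (intro summable_mult) (use inverse_power_summable[of 2] in \<open>simp add: field_simps\<close>)
    show "\<forall>\<^sub>F k in sequentially. fails_within M (C * (1 / real k ^ 2))
      (\<lambda>\<omega>. \<forall>u\<in>{0..1}. \<forall>v\<in>{0..1}. \<bar>u - v\<bar> \<le> 1 / real k ^ p \<longrightarrow>
        \<bar>W \<sigma> u \<omega> - W \<sigma> v \<omega>\<bar> \<le> (1 + 3 * \<theta>) * sqrt \<sigma> * levy_scale (1 / real k ^ p))"
      using eventually_ge_at_top[of 2]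
    proof eventually_elim
      case (elim k)
      then have k: "real k \<ge> 2" by simp
      define n where "n = k ^ p"
      have n_eq: "real k ^ p = real n" by (simp add: n_def)
      have "1 < k ^ p" using elim p0 by (intro one_less_power) auto
      then have n: "real n > 1" by (metis n_def of_nat_1 of_nat_less_iff)
      then have n1: "real n \<ge> 1" by simp
      define N where "N = K * n"
      have N: "real N = K * real n" by (simp add: N_def)
      have N1: "real N \<ge> 1" unfolding N using K1 n1 mult_mono[of 1 "real K" 1 "real n"] by simp
      define h where "h = levy_scale (1 / real n)"
      have h: "h > 0" using n by (simp add: h_def levy_scale_pos)
      have hh: "h\<^sup>2 = 2 * ln n / n" unfolding h_def by (rule levy_scale_inverse_square[OF n1])
      have ln0: "ln (real n) > 0" using n by simp
      \<comment> \<open>This is \<open>n powr (- (1 + 2 * \<theta>))\<close>, a common bound for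
        both exponentials; for the grid pairs it comes from
        \<open>(1 + \<theta>)^2 \<ge> 1 + 2 * \<theta>\<close>.\<close>
      define q where "q = exp (- ((1 + 2 * \<theta>) * ln (real n)))"
      define x where "x = \<theta> * sqrt \<sigma> * h"
      define y where "y = (1 + \<theta>) * sqrt \<sigma> * h"
      have x: "x > 0" and y: "y > 0" using \<theta> \<sigma> h by (simp_all add: x_def y_def)
      have cells: "fails_within M (16 * K * n * q)
        (\<lambda>\<omega>. \<forall>i\<in>{..N}. \<forall>t\<in>{real i / N..real i / N + 1 / N}. \<bar>W \<sigma> t \<omega> - W \<sigma> (real i / N) \<omega>\<bar> \<le> x)"
      proof (rule fails_within_ball)
        show "fails_within M (8 * exp (- x\<^sup>2 / (256 * \<sigma> * (1 / N))))
          (\<lambda>\<omega>. \<forall>t\<in>{real i / N..real i / N + 1 / N}. \<bar>W \<sigma> t \<omega> - W \<sigma> (real i / N) \<omega>\<bar> \<le> x)" for i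
          using \<sigma> x N1 by (intro increment_sup_tail) auto
        have "x\<^sup>2 / (256 * \<sigma> * (1 / N)) = \<theta>\<^sup>2 * K / 128 * ln n"
          using \<sigma> n unfolding x_def power_mult_distrib hh N by (simp add: field_simps)
        moreover have "3 * ln n \<le> \<theta>\<^sup>2 * K / 128 * ln n" using K2 ln0 by (intro mult_right_mono) auto
        moreover have "(1 + 2 * \<theta>) * ln n \<le> 3 * ln n" using \<theta> ln0 by (intro mult_right_mono) auto
        ultimately have "(1 + 2 * \<theta>) * ln n \<le> x\<^sup>2 / (256 * \<sigma> * (1 / N))" by linarith
        then have e: "exp (- x\<^sup>2 / (256 * \<sigma> * (1 / N))) \<le> q" by (simp add: q_def)
        have "real (card {..N}) \<le> 2 * real N" using N1 by simp
        then have "real (card {..N}) * (8 * exp (- x\<^sup>2 / (256 * \<sigma> * (1 / N)))) \<le> (2 * real N) * (8 * q)"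
          using e by (intro mult_mono) auto
        then show "real (card {..N}) * (8 * exp (- x\<^sup>2 / (256 * \<sigma> * (1 / N)))) \<le> 16 * K * n * q"
          by (simp add: N)
      qed simp
      have pairs: "fails_within M (4 * K * K * n * q)
        (\<lambda>\<omega>. \<forall>(i, l)\<in>{..N} \<times> {1..K}. \<bar>W \<sigma> (real (i + l) / N) \<omega> - W \<sigma> (real i / N) \<omega>\<bar> \<le> y)"
      proof (rule fails_within_ball)
        fix il assume il: "il \<in> {..N} \<times> {1..K}"
        obtain i l where il_eq: "il = (i, l)" by (cases il)
        have l: "1 \<le> real l" "real l \<le> K" using il il_eq by auto
        have lN: "0 < real l / N" "real l / N \<le> 1 / n"
          using l N1 n K0 unfolding N by (auto simp: field_simps)
        have "0 < \<sigma> * (real l / N)" using \<sigma> lN by (intro mult_pos_pos)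
        have diff: "real (i + l) / N - real i / N = real l / N" by (simp add: add_divide_distrib)
        have "(\<lambda>\<omega>. W \<sigma> (real (i + l) / N) \<omega> - W \<sigma> (real i / N) \<omega>) \<in> lin_span"
          using \<sigma> by (intro lin_span_diff lin_span_W) auto
        moreover have "cov (\<lambda>\<omega>. W \<sigma> (real (i + l) / N) \<omega> - W \<sigma> (real i / N) \<omega>)
            (\<lambda>\<omega>. W \<sigma> (real (i + l) / N) \<omega> - W \<sigma> (real i / N) \<omega>) = \<sigma> * (real l / N)"
          unfolding diff[symmetric] using \<sigma> by (intro cov_increment) (auto simp: divide_right_mono)
        ultimately have "fails_within M (2 * exp (- y\<^sup>2 / (2 * (\<sigma> * (real l / N)))))
          (\<lambda>\<omega>. \<bar>W \<sigma> (real (i + l) / N) \<omega> - W \<sigma> (real i / N) \<omega>\<bar> \<le> y)"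
          using lin_span_tail[OF _ _ _ y] \<open>0 < \<sigma> * (real l / N)\<close> by blast
        moreover have "2 * exp (- y\<^sup>2 / (2 * (\<sigma> * (real l / N)))) \<le> 2 * q"
        proof -
          have "(1 + 2 * \<theta>) * ln n \<le> (1 + \<theta>)\<^sup>2 * ln n"
            using ln0 by (intro mult_right_mono) (auto simp: power2_eq_square algebra_simps)
          also have "\<dots> = y\<^sup>2 / (2 * (\<sigma> * (1 / n)))"
            using \<sigma> n unfolding y_def power_mult_distrib hh by (simp add: field_simps)
          also have "\<dots> \<le> y\<^sup>2 / (2 * (\<sigma> * (real l / N)))"
            using lN \<sigma> n by (intro divide_left_mono mult_left_mono mult_pos_pos) auto
          finally show ?thesis by (simp add: q_def)
        qed
        ultimately show "fails_within M (2 * q)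
          (\<lambda>\<omega>. case il of (i, l) \<Rightarrow> \<bar>W \<sigma> (real (i + l) / N) \<omega> - W \<sigma> (real i / N) \<omega>\<bar> \<le> y)"
          unfolding il_eq by (rule fails_within_mono) simp
      next
        have "real (card ({..N} \<times> {1..K})) * (2 * q) = (real N + 1) * K * (2 * q)"
          by (simp add: card_cartesian_product algebra_simps)
        also have "\<dots> \<le> (2 * real N) * K * (2 * q)"
          using N1 by (intro mult_right_mono) (auto simp: q_def)
        finally show "real (card ({..N} \<times> {1..K})) * (2 * q) \<le> 4 * K * K * n * q"
          by (simp add: N)
      qed simp
      show ?case unfolding n_eq
      proof (rule fails_within_mono[OF fails_within_conj[OF cells pairs]])
        have "real n * q = (real k ^ p) powr (- (2 * \<theta>))"
          using n unfolding n_eq q_def powr_def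
          by (simp add: algebra_simps exp_add exp_diff exp_minus inverse_eq_divide)
        also have "\<dots> \<le> 1 / real k ^ 2" using k p2 by (intro power_powr_le) auto
        finally have "C * (real n * q) \<le> C * (1 / real k ^ 2)"
          using K0 by (intro mult_left_mono) (auto simp: C_def)
        then show "16 * K * n * q + 4 * K * K * n * q \<le> C * (1 / real k ^ 2)"
          by (simp add: C_def algebra_simps)
        fix \<omega>
        assume \<omega>: "(\<forall>i\<in>{..N}. \<forall>t\<in>{real i / N..real i / N + 1 / N}. \<bar>W \<sigma> t \<omega> - W \<sigma> (real i / N) \<omega>\<bar> \<le> x) \<and>
          (\<forall>(i, l)\<in>{..N} \<times> {1..K}. \<bar>W \<sigma> (real (i + l) / N) \<omega> - W \<sigma> (real i / N) \<omega>\<bar> \<le> y)"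
        show "\<forall>u\<in>{0..1}. \<forall>v\<in>{0..1}. \<bar>u - v\<bar> \<le> 1 / real n \<longrightarrow>
          \<bar>W \<sigma> u \<omega> - W \<sigma> v \<omega>\<bar> \<le> (1 + 3 * \<theta>) * sqrt \<sigma> * levy_scale (1 / real n)"
        proof (intro ballI impI)
          fix u v :: real assume uv: "u \<in> {0..1}" "v \<in> {0..1}" "\<bar>u - v\<bar> \<le> 1 / real n"
          have "\<bar>(\<lambda>t. W \<sigma> t \<omega>) u - (\<lambda>t. W \<sigma> t \<omega>) v\<bar> \<le> y + 2 * x"
          proof (rule grid_bound[where N = N and K = K and R = "\<lambda>t. W \<sigma> t \<omega>"])
            show "\<bar>u - v\<bar> \<le> real K / real N" using uv K0 n by (simp add: N)
          qed (use \<omega> uv N1 y in auto)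
          also have "y + 2 * x = (1 + 3 * \<theta>) * sqrt \<sigma> * levy_scale (1 / real n)"
            by (simp add: x_def y_def h_def algebra_simps)
          finally show "\<bar>W \<sigma> u \<omega> - W \<sigma> v \<omega>\<bar> \<le> (1 + 3 * \<theta>) * sqrt \<sigma> * levy_scale (1 / real n)" .
        qed
      qed
    qed
  qed
  with p0 show ?thesis by blast
qed

end

section \<open>The lower bound by the second moment method\<close>

lemma (in prob_space) prob_avoid_all_le:
  fixes q :: real
  assumes A: "\<And>i. i \<in> I \<Longrightarrow> A i \<in> sets M" and I: "finite I" "I \<noteq> {}"
    and q: "\<And>i. i \<in> I \<Longrightarrow> prob (A i) = q" "q > 0"
    and qq: "\<And>i j. i \<in> I \<Longrightarrow> j \<in> I \<Longrightarrow> i \<noteq> j \<Longrightarrow> prob (A i \<inter> A j) = q * q"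
  shows "prob (space M - (\<Union>i\<in>I. A i)) \<le> 1 / (card I * q)"
proof -
  define n where "n = real (card I)"
  have n: "n > 0" using I by (simp add: n_def card_gt_0_iff)
  \<comment> \<open>Chebyshev's inequality for the number of events that occur. Under pairwise
    independence its variance is at most its mean \<open>n * q\<close>, and \<open>N = 0\<close> is
    a deviation by the whole mean.\<close>
  define N where "N \<omega> = (\<Sum>i\<in>I. indicator (A i) \<omega> :: real)" for \<omega>
  have [measurable]: "N \<in> borel_measurable M"
    unfolding N_def using A by (intro borel_measurable_sum) auto
  have int0: "integrable M (indicator (A i) :: 'a \<Rightarrow> real)" if "i \<in> I" for i
    using A that by (intro integrable_real_indicator) (auto simp: less_top[symmetric])
  have EN: "expectation N = n * q"
    unfolding N_def using A q I int0
    by (subst Bochner_Integration.integral_sum) (auto simp: n_def)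
  have N2: "(N \<omega>)\<^sup>2 = (\<Sum>i\<in>I. \<Sum>j\<in>I. indicator (A i \<inter> A j) \<omega>)" for \<omega>
    unfolding N_def power2_eq_square by (simp add: sum_product indicator_inter_arith)
  have int: "integrable M (indicator (A i \<inter> A j) :: 'a \<Rightarrow> real)" if "i \<in> I" "j \<in> I" for i j
    using A that by (intro integrable_real_indicator sets.Int) (auto simp: less_top[symmetric])
  have int2: "integrable M (\<lambda>\<omega>. (N \<omega>)\<^sup>2)"
    unfolding N2 using int by (intro Bochner_Integration.integrable_sum) auto
  have int1: "integrable M N"
    unfolding N_def using int0 by (intro Bochner_Integration.integrable_sum) auto
  have "expectation (\<lambda>\<omega>. (N \<omega>)\<^sup>2) = (\<Sum>i\<in>I. \<Sum>j\<in>I. prob (A i \<inter> A j))"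
    unfolding N2 using int A
    by (subst Bochner_Integration.integral_sum, simp)
       (intro sum.cong refl, subst Bochner_Integration.integral_sum, auto)
  also have "\<dots> \<le> (\<Sum>i\<in>I. \<Sum>j\<in>I. (if i = j then q else 0) + q * q)"
  proof (intro sum_mono)
    fix i j assume "i \<in> I" "j \<in> I"
    then show "prob (A i \<inter> A j) \<le> (if i = j then q else 0) + q * q"
      using q qq by (cases "i = j") auto
  qed
  also have "\<dots> = n * q + (n * q)\<^sup>2"
    using I by (simp add: sum.distrib n_def power2_eq_square algebra_simps)
  finally have var: "variance N \<le> n * q"
    using int1 int2 by (subst variance_eq) (auto simp: EN)
  have "prob {\<omega>\<in>space M. \<bar>N \<omega> - n * q\<bar> \<ge> n * q} \<le> variance N / (n * q)\<^sup>2"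
    using Chebyshev_inequality[of N "n * q"] int2 n q EN by simp
  also have "\<dots> \<le> n * q / (n * q)\<^sup>2" using var by (intro divide_right_mono) auto
  also have "\<dots> = 1 / (n * q)" using n q by (simp add: power2_eq_square)
  finally have "prob {\<omega>\<in>space M. \<bar>N \<omega> - n * q\<bar> \<ge> n * q} \<le> 1 / (n * q)" .
  moreover have "prob (space M - (\<Union>i\<in>I. A i)) \<le> prob {\<omega>\<in>space M. \<bar>N \<omega> - n * q\<bar> \<ge> n * q}"
  proof (rule finite_measure_mono)
    show "space M - (\<Union>i\<in>I. A i) \<subseteq> {\<omega>\<in>space M. \<bar>N \<omega> - n * q\<bar> \<ge> n * q}"
    proof
      fix \<omega> assume \<omega>: "\<omega> \<in> space M - (\<Union>i\<in>I. A i)"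
      then have "N \<omega> = 0" unfolding N_def by (intro sum.neutral) auto
      then show "\<omega> \<in> {\<omega>\<in>space M. \<bar>N \<omega> - n * q\<bar> \<ge> n * q}" using \<omega> by simp
    qed
  qed measurable
  ultimately show ?thesis by (simp add: n_def)
qed

context sheet
begin

text \<open>Among the \<open>n\<close> successive increments of length \<open>1 / n\<close>, the
  expected number of large ones is at least of order \<open>n powr \<theta>\<close>. So the
  probability that there is none is at most of order \<open>n powr (- \<theta>)\<close>, which the
  choice of \<open>p\<close> makes summable along \<open>n = k ^ p\<close>.\<close>

lemma increments_lower:
  assumes \<sigma>: "\<sigma> > 0" and \<theta>: "0 < \<theta>" "\<theta> < 1"
  shows "\<exists>p>0. AE \<omega> in M. \<forall>\<^sub>F k in sequentially. \<exists>u\<in>{0..1}. \<exists>v\<in>{0..1}. \<bar>u - v\<bar> \<le> 1 / real k ^ p \<and>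
    (1 - \<theta>) * sqrt \<sigma> * levy_scale (1 / real k ^ p) \<le> \<bar>W \<sigma> u \<omega> - W \<sigma> v \<omega>\<bar>"
proof -
  obtain p :: nat where p: "real p \<ge> 2 / \<theta>" using real_arch_simple by blast
  have p0: "p > 0" using p \<theta> by (smt (verit) divide_pos_pos of_nat_0_less_iff)
  have p2: "p * \<theta> \<ge> 2" using p \<theta> by (simp add: field_simps)
  \<comment> \<open>The \<open>\<theta>\<close>-dependent constant is what remains after the mixed
    term of \<open>(m + 1)^2\<close> has been split by
    \<open>2 * m \<le> \<theta> * m^2 + 1 / \<theta>\<close>.\<close>
  define c where "c = exp (- (1 + 1 / \<theta>) / 2) / sqrt (2 * pi)"
  have c: "c > 0" by (simp add: c_def)
  have "AE \<omega> in M. \<forall>\<^sub>F k in sequentially. \<exists>u\<in>{0..1}. \<exists>v\<in>{0..1}. \<bar>u - v\<bar> \<le> 1 / real k ^ p \<and>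
    (1 - \<theta>) * sqrt \<sigma> * levy_scale (1 / real k ^ p) \<le> \<bar>W \<sigma> u \<omega> - W \<sigma> v \<omega>\<bar>"
  proof (rule fails_within_eventually)
    show "summable (\<lambda>k. 1 / c * (1 / real k ^ 2))"
      by (intro summable_mult) (use inverse_power_summable[of 2] in \<open>simp add: field_simps\<close>)
    show "\<forall>\<^sub>F k in sequentially. fails_within M (1 / c * (1 / real k ^ 2))
      (\<lambda>\<omega>. \<exists>u\<in>{0..1}. \<exists>v\<in>{0..1}. \<bar>u - v\<bar> \<le> 1 / real k ^ p \<and>
        (1 - \<theta>) * sqrt \<sigma> * levy_scale (1 / real k ^ p) \<le> \<bar>W \<sigma> u \<omega> - W \<sigma> v \<omega>\<bar>)"
      using eventually_ge_at_top[of 2]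
    proof eventually_elim
      case (elim k)
      then have k: "real k \<ge> 2" by simp
      define n where "n = k ^ p"
      have n_eq: "real k ^ p = real n" by (simp add: n_def)
      have "1 < k ^ p" using elim p0 by (intro one_less_power) auto
      then have n: "real n > 1" by (metis n_def of_nat_1 of_nat_less_iff)
      have ln0: "ln (real n) > 0" using n by simp
      define X where "X i = (\<lambda>\<omega>. sqrt (n / \<sigma>) * (W \<sigma> (real (Suc i) / n) \<omega> - W \<sigma> (real i / n) \<omega>))" for i
      have inc: "(\<lambda>\<omega>. W \<sigma> (real (Suc i) / n) \<omega> - W \<sigma> (real i / n) \<omega>) \<in> lin_span" for i
        using \<sigma> by (intro lin_span_diff lin_span_W) auto
      have X: "X i \<in> lin_span" for i
        unfolding X_def using inc by (rule lin_span_scale)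
      note [measurable] = measurable_lin_span[OF X]
      have Xii: "cov (X i) (X i) = 1" for i
      proof -
        have "cov (X i) (X i) = sqrt (n / \<sigma>) * (sqrt (n / \<sigma>) * (\<sigma> * (real (Suc i) / n - real i / n)))"
          unfolding X_def cov_scale using \<sigma> by (subst cov_increment) (auto simp: divide_right_mono)
        also have "\<dots> = n / \<sigma> * (\<sigma> * (1 / n))"
          using \<sigma> by (simp add: mult.assoc[symmetric] diff_divide_distrib[symmetric])
        finally show ?thesis using \<sigma> n by simp
      qed
      have Xij: "cov (X i) (X j) = 0" if "i < j" for i j
        unfolding X_def cov_scale using \<sigma> that
        by (subst cov_disjoint_increments) (auto simp: divide_right_mono)
      then have Xij': "cov (X i) (X j) = 0" if "i \<noteq> j" for i j
        using that cov_sym[of "X i" "X j"] by (cases "i < j") auto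
      have dist: "distributed M lborel (X i) (\<lambda>x. ennreal (std_normal_density x))" for i
        using gaussian_variable_centered[OF gaussian_lin_span[OF X[of i]] expectation_lin_span[OF X[of i]], of 1] Xii[of i]
        by (simp add: cov_def power2_eq_square)
      \<comment> \<open>The target
        \<open>(1 - \<theta>) * sqrt \<sigma> * levy_scale (1 / n)\<close> after normalising the
        increment by \<open>sqrt (n / \<sigma>)\<close>.\<close>
      define m where "m = (1 - \<theta>) * sqrt (2 * ln n)"
      have m: "m \<ge> 0" using \<theta> ln0 by (simp add: m_def)
      define A where "A i = {\<omega>\<in>space M. X i \<omega> \<in> {m..}}" for i
      have A: "A i \<in> sets M" for i unfolding A_def by measurable
      define q where "q = measure (density lborel (\<lambda>x. ennreal (std_normal_density x))) {m..}"
      have Aq: "prob (A i) = q" for i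
      proof -
        have "prob (A i) = measure (distr M lborel (X i)) {m..}"
          unfolding A_def by (subst measure_distr) (auto intro!: arg_cong[where f = prob])
        then show ?thesis using dist[of i] by (simp add: distributed_def q_def)
      qed
      have low: "c * exp (- ((1 - \<theta>) * ln n)) \<le> q"
      proof -
        have "2 * m \<le> \<theta> * m\<^sup>2 + 1 / \<theta>"
        proof -
          have "0 \<le> (\<theta> * m - 1)\<^sup>2 / \<theta>" using \<theta> by simp
          also have "\<dots> = \<theta> * m\<^sup>2 + 1 / \<theta> - 2 * m" using \<theta> by (simp add: power2_eq_square field_simps)
          finally show ?thesis by simp
        qed
        then have "(m + 1)\<^sup>2 \<le> (1 + \<theta>) * m\<^sup>2 + (1 + 1 / \<theta>)"
          by (simp add: power2_eq_square algebra_simps)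
        \<comment> \<open>One factor \<open>1 - \<theta>\<close> of \<open>m^2\<close> cancels the
          \<open>1 + \<theta>\<close> lost in splitting the mixed term; the other one stays in the
          exponent and produces the gain \<open>n powr \<theta>\<close>.\<close>
        moreover have "(1 + \<theta>) * m\<^sup>2 \<le> 2 * ((1 - \<theta>) * ln n)"
        proof -
          have "(1 + \<theta>) * m\<^sup>2 = (1 + \<theta>) * (1 - \<theta>) * ((1 - \<theta>) * (2 * ln n))"
            using ln0 by (simp add: m_def power_mult_distrib power2_eq_square)
          also have "\<dots> \<le> 1 * ((1 - \<theta>) * (2 * ln n))"
            using \<theta> ln0 by (intro mult_right_mono) (auto simp: algebra_simps)
          finally show ?thesis by simp
        qed
        moreover have "- l + - s / 2 \<le> - r / 2" if "r \<le> t + s" "t \<le> 2 * l" for l r s t :: real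
          using that by linarith
        ultimately have "- ((1 - \<theta>) * ln n) + - (1 + 1 / \<theta>) / 2 \<le> - (m + 1)\<^sup>2 / 2" by blast
        then have "exp (- ((1 - \<theta>) * ln n)) * exp (- (1 + 1 / \<theta>) / 2) \<le> exp (- (m + 1)\<^sup>2 / 2)"
          unfolding exp_add[symmetric] by simp
        then have "c * exp (- ((1 - \<theta>) * ln n)) \<le> exp (- (m + 1)\<^sup>2 / 2) / sqrt (2 * pi)"
          by (simp add: c_def divide_right_mono mult.commute)
        also have "\<dots> \<le> prob (A 0)" using std_normal_tail_lower[OF dist m, of 0] by (simp add: A_def)
        finally show ?thesis by (simp add: Aq)
      qed
      have q0: "q > 0" using low c by (smt (verit) exp_gt_zero mult_pos_pos)
      have "prob (space M - (\<Union>i\<in>{..<n}. A i)) \<le> 1 / (card {..<n} * q)"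
      proof (rule prob_avoid_all_le[OF A _ _ Aq q0])
        fix i j :: nat assume "i \<noteq> j"
        have "A i \<inter> A j = {\<omega>\<in>space M. X i \<omega> \<in> {m..} \<and> X j \<omega> \<in> {m..}}" by (auto simp: A_def)
        then show "prob (A i \<inter> A j) = q * q"
          using prob_conj_lin_span[OF X X Xij'[OF \<open>i \<noteq> j\<close>], of "{m..}" "{m..}"] Aq[of i] Aq[of j]
          by (simp add: A_def)
      qed (use n in \<open>auto simp: lessThan_empty_iff\<close>)
      also have "\<dots> \<le> 1 / c * (1 / real k ^ 2)"
      proof -
        have e: "real n * exp (- ((1 - \<theta>) * ln n)) = real n powr \<theta>"
          using n unfolding powr_def by (simp add: algebra_simps exp_add exp_diff exp_minus)
        have "c * (real n powr \<theta>) \<le> real n * q"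
          using mult_left_mono[OF low, of "real n"] unfolding e[symmetric] by (simp add: mult_ac)
        then have "1 / (real n * q) \<le> 1 / (c * (real n powr \<theta>))"
          using c n q0 by (intro divide_left_mono mult_pos_pos) auto
        also have "\<dots> = 1 / c * (real n powr (- \<theta>))"
          by (simp add: powr_minus divide_inverse)
        also have "\<dots> \<le> 1 / c * (1 / real k ^ 2)"
          unfolding n_eq[symmetric] using k p2 c by (intro mult_left_mono power_powr_le) auto
        finally show ?thesis by simp
      qed
      finally have pr: "prob (space M - (\<Union>i\<in>{..<n}. A i)) \<le> 1 / c * (1 / real k ^ 2)" .
      show ?case unfolding n_eq fails_within_def
      proof (intro bexI[of _ "space M - (\<Union>i\<in>{..<n}. A i)"] conjI ballI)
        show "prob (space M - (\<Union>i\<in>{..<n}. A i)) \<le> 1 / c * (1 / real k ^ 2)" by (rule pr)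
        show "space M - (\<Union>i\<in>{..<n}. A i) \<in> events" using A by auto
        fix \<omega> assume "\<omega> \<in> space M - (space M - (\<Union>i\<in>{..<n}. A i))"
        then obtain i where i: "i < n" and Xm: "m \<le> X i \<omega>" by (auto simp: A_def)
        let ?d = "W \<sigma> (real (Suc i) / n) \<omega> - W \<sigma> (real i / n) \<omega>"
        have "(1 - \<theta>) * sqrt \<sigma> * levy_scale (1 / real n) = m * sqrt (\<sigma> / n)"
          by (simp add: m_def levy_scale_def real_sqrt_mult[symmetric] real_sqrt_divide mult.commute)
        also have "\<dots> \<le> X i \<omega> * sqrt (\<sigma> / n)" using Xm \<sigma> by (intro mult_right_mono) auto
        also have "\<dots> = ?d" using \<sigma> n by (simp add: X_def real_sqrt_divide)
        also have "\<dots> \<le> \<bar>?d\<bar>" by simp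
        finally have "(1 - \<theta>) * sqrt \<sigma> * levy_scale (1 / real n) \<le> \<bar>?d\<bar>" .
        moreover have "real (Suc i) / n \<in> {0..1}" "real i / n \<in> {0..1}" using i by auto
        moreover have "\<bar>real (Suc i) / n - real i / n\<bar> \<le> 1 / real n" by (simp add: diff_divide_distrib[symmetric])
        ultimately show "\<exists>u\<in>{0..1}. \<exists>v\<in>{0..1}. \<bar>u - v\<bar> \<le> 1 / real n \<and>
          (1 - \<theta>) * sqrt \<sigma> * levy_scale (1 / real n) \<le> \<bar>W \<sigma> u \<omega> - W \<sigma> v \<omega>\<bar>" by blast
      qed
    qed
  qed
  with p0 show ?thesis by blast
qed

end

section \<open>The modulus of the Ornstein--Uhlenbeck process\<close>

context sheet
begin

lemma levy_modulus_fixed: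
  assumes \<sigma>: "\<sigma> > 0"
  shows "AE \<omega> in M. levy_modulus (sqrt \<sigma>) (\<lambda>t. W \<sigma> t \<omega>)"
proof -
  \<comment> \<open>A sequence of tolerances, so that countably many null sets suffice. It stays at
    most 1/2, which makes \<open>1 - 2 * \<theta> j\<close> nonnegative as
    \<open>lower_bound_of_power_scale\<close> requires. The extra \<open>\<theta> j\<close> in both
    bounds below pays for the passage from the scales \<open>1 / k ^ p\<close> to all real
    \<open>\<epsilon>\<close>.\<close>
  define \<theta> where "\<theta> j = 1 / real (j + 2)" for j :: nat
  have \<theta>: "0 < \<theta> j" "\<theta> j < 1" for j by (simp_all add: \<theta>_def)
  have up: "AE \<omega> in M. \<forall>\<^sub>F \<epsilon> in at_right 0. \<forall>u\<in>{0..1}. \<forall>v\<in>{0..1}. \<bar>u - v\<bar> \<le> \<epsilon> \<longrightarrow>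
      \<bar>W \<sigma> u \<omega> - W \<sigma> v \<omega>\<bar> \<le> (1 + 4 * \<theta> j) * sqrt \<sigma> * levy_scale \<epsilon>" for j
  proof -
    from increments_upper[OF \<sigma> \<theta>(1)[of j] less_imp_le[OF \<theta>(2)[of j]]]
    obtain p where p: "p > 0" and "AE \<omega> in M. \<forall>\<^sub>F k in sequentially. \<forall>u\<in>{0..1}. \<forall>v\<in>{0..1}. \<bar>u - v\<bar> \<le> 1 / real k ^ p \<longrightarrow>
      \<bar>W \<sigma> u \<omega> - W \<sigma> v \<omega>\<bar> \<le> (1 + 3 * \<theta> j) * sqrt \<sigma> * levy_scale (1 / real k ^ p)" by blast
    from this(2) show ?thesis
    proof eventually_elim
      case (elim \<omega>)
      show ?case
        by (rule upper_bound_of_power_scale[OF p _ _ elim]) (use \<theta>[of j] \<sigma> in auto)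
    qed
  qed
  have low: "AE \<omega> in M. \<forall>\<^sub>F \<epsilon> in at_right 0. \<exists>u\<in>{0..1}. \<exists>v\<in>{0..1}. \<bar>u - v\<bar> \<le> \<epsilon> \<and>
      (1 - 2 * \<theta> j) * sqrt \<sigma> * levy_scale \<epsilon> \<le> \<bar>W \<sigma> u \<omega> - W \<sigma> v \<omega>\<bar>" for j
  proof -
    from increments_lower[OF \<sigma> \<theta>[of j]]
    obtain p where p: "p > 0" and "AE \<omega> in M. \<forall>\<^sub>F k in sequentially. \<exists>u\<in>{0..1}. \<exists>v\<in>{0..1}. \<bar>u - v\<bar> \<le> 1 / real k ^ p \<and>
      (1 - \<theta> j) * sqrt \<sigma> * levy_scale (1 / real k ^ p) \<le> \<bar>W \<sigma> u \<omega> - W \<sigma> v \<omega>\<bar>" by blast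
    from this(2) show ?thesis
    proof eventually_elim
      case (elim \<omega>)
      have "2 * \<theta> j \<le> 1" by (simp add: \<theta>_def)
      then show ?case
        by (intro lower_bound_of_power_scale[OF p _ _ elim]) (use \<theta>[of j] \<sigma> in auto)
    qed
  qed
  from up low have "AE \<omega> in M. (\<forall>j. \<forall>\<^sub>F \<epsilon> in at_right 0. \<forall>u\<in>{0..1}. \<forall>v\<in>{0..1}. \<bar>u - v\<bar> \<le> \<epsilon> \<longrightarrow>
      \<bar>W \<sigma> u \<omega> - W \<sigma> v \<omega>\<bar> \<le> (1 + 4 * \<theta> j) * sqrt \<sigma> * levy_scale \<epsilon>) \<and>
    (\<forall>j. \<forall>\<^sub>F \<epsilon> in at_right 0. \<exists>u\<in>{0..1}. \<exists>v\<in>{0..1}. \<bar>u - v\<bar> \<le> \<epsilon> \<and>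
      (1 - 2 * \<theta> j) * sqrt \<sigma> * levy_scale \<epsilon> \<le> \<bar>W \<sigma> u \<omega> - W \<sigma> v \<omega>\<bar>)"
    by (simp add: AE_all_countable)
  then show ?thesis
  proof eventually_elim
    case (elim \<omega>)
    show ?case unfolding levy_modulus_def
    proof (intro allI impI)
      fix e :: real assume e: "e > 0"
      obtain j :: nat where j: "real j \<ge> 4 * sqrt \<sigma> / e" using real_arch_simple by blast
      have "4 * sqrt \<sigma> \<le> real j * e" using j e by (simp add: field_simps)
      also have "\<dots> \<le> real (j + 2) * e" using e by (intro mult_right_mono) auto
      finally have je: "4 * \<theta> j * sqrt \<sigma> \<le> e" by (simp add: \<theta>_def field_simps)
      moreover have "2 * \<theta> j * sqrt \<sigma> \<le> 4 * \<theta> j * sqrt \<sigma>"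
        using \<theta>(1)[of j] \<sigma> by (intro mult_right_mono) auto
      ultimately have je': "2 * \<theta> j * sqrt \<sigma> \<le> e" by linarith
      have c: "(1 + 4 * \<theta> j) * sqrt \<sigma> * levy_scale \<epsilon> \<le> (sqrt \<sigma> + e) * levy_scale \<epsilon>"
        "(sqrt \<sigma> - e) * levy_scale \<epsilon> \<le> (1 - 2 * \<theta> j) * sqrt \<sigma> * levy_scale \<epsilon>" if "0 < \<epsilon> \<and> \<epsilon> < 1" for \<epsilon>
      proof -
        have "(1 + 4 * \<theta> j) * sqrt \<sigma> \<le> sqrt \<sigma> + e" "sqrt \<sigma> - e \<le> (1 - 2 * \<theta> j) * sqrt \<sigma>"
          using je je' by (simp_all add: algebra_simps)
        then show "(1 + 4 * \<theta> j) * sqrt \<sigma> * levy_scale \<epsilon> \<le> (sqrt \<sigma> + e) * levy_scale \<epsilon>"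
          "(sqrt \<sigma> - e) * levy_scale \<epsilon> \<le> (1 - 2 * \<theta> j) * sqrt \<sigma> * levy_scale \<epsilon>"
          using that levy_scale_nonneg[of \<epsilon>] by (simp_all only: mult_right_mono less_imp_le)
      qed
      have up: "\<forall>\<^sub>F \<epsilon> in at_right 0. \<forall>u\<in>{0..1}. \<forall>v\<in>{0..1}. \<bar>u - v\<bar> \<le> \<epsilon> \<longrightarrow>
          \<bar>W \<sigma> u \<omega> - W \<sigma> v \<omega>\<bar> \<le> (1 + 4 * \<theta> j) * sqrt \<sigma> * levy_scale \<epsilon>"
        and low: "\<forall>\<^sub>F \<epsilon> in at_right 0. \<exists>u\<in>{0..1}. \<exists>v\<in>{0..1}. \<bar>u - v\<bar> \<le> \<epsilon> \<and>
          (1 - 2 * \<theta> j) * sqrt \<sigma> * levy_scale \<epsilon> \<le> \<bar>W \<sigma> u \<omega> - W \<sigma> v \<omega>\<bar>"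
        using elim by blast+
      show "(\<forall>\<^sub>F \<epsilon> in at_right 0. \<forall>u\<in>{0..1}. \<forall>v\<in>{0..1}. \<bar>u - v\<bar> \<le> \<epsilon> \<longrightarrow>
          \<bar>W \<sigma> u \<omega> - W \<sigma> v \<omega>\<bar> \<le> (sqrt \<sigma> + e) * levy_scale \<epsilon>) \<and>
        (\<forall>\<^sub>F \<epsilon> in at_right 0. \<exists>u\<in>{0..1}. \<exists>v\<in>{0..1}. \<bar>u - v\<bar> \<le> \<epsilon> \<and>
          (sqrt \<sigma> - e) * levy_scale \<epsilon> \<le> \<bar>W \<sigma> u \<omega> - W \<sigma> v \<omega>\<bar>)"
      proof
        show "\<forall>\<^sub>F \<epsilon> in at_right 0. \<forall>u\<in>{0..1}. \<forall>v\<in>{0..1}. \<bar>u - v\<bar> \<le> \<epsilon> \<longrightarrow>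
          \<bar>W \<sigma> u \<omega> - W \<sigma> v \<omega>\<bar> \<le> (sqrt \<sigma> + e) * levy_scale \<epsilon>"
          using up eventually_at_right_unit by eventually_elim (use c(1) in \<open>blast intro: order_trans\<close>)
        show "\<forall>\<^sub>F \<epsilon> in at_right 0. \<exists>u\<in>{0..1}. \<exists>v\<in>{0..1}. \<bar>u - v\<bar> \<le> \<epsilon> \<and>
          (sqrt \<sigma> - e) * levy_scale \<epsilon> \<le> \<bar>W \<sigma> u \<omega> - W \<sigma> v \<omega>\<bar>"
          using low eventually_at_right_unit by eventually_elim (use c(2) in \<open>blast intro: order_trans\<close>)
      qed
    qed
  qed
qed

lemma levy_modulus_all: "AE \<omega> in M. \<forall>\<tau>>0. levy_modulus (sqrt \<tau>) (\<lambda>t. W \<tau> t \<omega>)"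
proof -
  define \<eta> where "\<eta> j = 1 / real (Suc j)" for j :: nat
  have \<eta>: "\<eta> j > 0" for j by (simp add: \<eta>_def)
  define P where "P \<delta> j \<sigma> \<omega> \<longleftrightarrow> (\<forall>\<^sub>F k in sequentially. \<forall>\<tau>\<in>{\<sigma>..\<sigma> + \<delta>}. \<forall>u\<in>{0..1}. \<forall>v\<in>{0..1}.
    \<bar>u - v\<bar> \<le> 1 / real k \<longrightarrow>
    \<bar>(W \<tau> u \<omega> - W \<tau> v \<omega>) - (W \<sigma> u \<omega> - W \<sigma> v \<omega>)\<bar> \<le> \<eta> j * levy_scale (1 / real k))" for \<delta> j \<sigma> \<omega>
  have "\<exists>\<delta>>0. \<forall>\<sigma>\<ge>0. AE \<omega> in M. P \<delta> j \<sigma> \<omega>" for j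
    unfolding P_def by (rule fluctuation[OF \<eta>])
  then obtain \<delta> where \<delta>: "\<And>j. \<delta> j > 0" "\<And>j \<sigma>. \<sigma> \<ge> 0 \<Longrightarrow> AE \<omega> in M. P (\<delta> j) j \<sigma> \<omega>" by metis
  define Q where "Q = \<rat> \<inter> {0::real<..}"
  have Q: "countable Q" unfolding Q_def by (intro countable_Int1 countable_rat)
  have "AE \<omega> in M. \<forall>\<sigma>\<in>Q. levy_modulus (sqrt \<sigma>) (\<lambda>t. W \<sigma> t \<omega>)"
    using levy_modulus_fixed by (subst AE_ball_countable[OF Q]) (auto simp: Q_def)
  moreover have "AE \<omega> in M. \<forall>\<sigma>\<in>Q. \<forall>j. P (\<delta> j) j \<sigma> \<omega>"
    using \<delta>(2) by (subst AE_ball_countable[OF Q]) (auto simp: Q_def AE_all_countable)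
  ultimately show ?thesis
  proof eventually_elim
    case (elim \<omega>)
    show ?case
    proof (intro allI impI levy_modulus_approx)
      fix \<tau> e :: real assume \<tau>: "\<tau> > 0" and e: "e > 0"
      obtain j where j: "\<eta> j < e / 2" using reals_Archimedean[of "e / 2"] e by (auto simp: \<eta>_def inverse_eq_divide)
      have "(\<lambda>s. sqrt s) \<midarrow>\<tau>\<rightarrow> sqrt \<tau>" by (intro tendsto_intros)
      then obtain d where d: "d > 0" "\<And>s. s \<noteq> \<tau> \<Longrightarrow> \<bar>s - \<tau>\<bar> < d \<Longrightarrow> \<bar>sqrt s - sqrt \<tau>\<bar> < e"
        using e unfolding LIM_def dist_real_def by blast
      \<comment> \<open>The rational \<open>\<sigma>\<close> is taken to the left of
        \<open>\<tau>\<close> because the fluctuation bound runs forward from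
        \<open>\<sigma>\<close>. It must be positive, within \<open>\<delta> j\<close> of
        \<open>\<tau>\<close>, and so close that \<open>sqrt \<sigma>\<close> is within
        \<open>e\<close> of \<open>sqrt \<tau>\<close>. Such a choice exists because
        \<open>\<delta> j\<close> was fixed before \<open>\<sigma>\<close>.\<close>
      have "max 0 (max (\<tau> - d) (\<tau> - \<delta> j)) < \<tau>" using \<tau> d \<delta>(1)[of j] by simp
      then obtain \<sigma> where \<sigma>: "\<sigma> \<in> \<rat>" "max 0 (max (\<tau> - d) (\<tau> - \<delta> j)) < \<sigma>" "\<sigma> < \<tau>"
        using Rats_dense_in_real by blast
      then have \<sigma>Q: "\<sigma> \<in> Q" and \<tau>\<sigma>: "\<tau> \<in> {\<sigma>..\<sigma> + \<delta> j}" by (auto simp: Q_def)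
      \<comment> \<open>The exponent 1 is written out to match the power scales of
        \<open>upper_bound_of_power_scale\<close>.\<close>
      have "\<forall>\<^sub>F k in sequentially. \<forall>u\<in>{0..1}. \<forall>v\<in>{0..1}. \<bar>u - v\<bar> \<le> 1 / real k ^ 1 \<longrightarrow>
        \<bar>(W \<tau> u \<omega> - W \<tau> v \<omega>) - (W \<sigma> u \<omega> - W \<sigma> v \<omega>)\<bar> \<le> \<eta> j * levy_scale (1 / real k ^ 1)"
        using elim(2)[rule_format, OF \<sigma>Q, of j] unfolding P_def
        by eventually_elim (use \<tau>\<sigma> in auto)
      then have "\<forall>\<^sub>F \<epsilon> in at_right 0. \<forall>u\<in>{0..1}. \<forall>v\<in>{0..1}. \<bar>u - v\<bar> \<le> \<epsilon> \<longrightarrow>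
        \<bar>(W \<tau> u \<omega> - W \<tau> v \<omega>) - (W \<sigma> u \<omega> - W \<sigma> v \<omega>)\<bar> \<le> e * levy_scale \<epsilon>"
        by (rule upper_bound_of_power_scale[rotated -1]) (use \<eta>[of j] j in auto)
      moreover have "\<bar>sqrt \<tau> - sqrt \<sigma>\<bar> \<le> e" using d(2)[of \<sigma>] \<sigma> by auto
      ultimately show "\<exists>c' g. levy_modulus c' g \<and> \<bar>sqrt \<tau> - c'\<bar> \<le> e \<and>
        (\<forall>\<^sub>F \<epsilon> in at_right 0. \<forall>u\<in>{0..1}. \<forall>v\<in>{0..1}. \<bar>u - v\<bar> \<le> \<epsilon> \<longrightarrow>
          \<bar>(W \<tau> u \<omega> - W \<tau> v \<omega>) - (g u - g v)\<bar> \<le> e * levy_scale \<epsilon>)"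
        using elim(1) \<sigma>Q by blast
    qed
  qed
qed

lemma OU_process_levy_modulus: "AE \<omega> in M. \<forall>r. levy_modulus 1 (OU_process W r \<omega>)"
  using levy_modulus_all
proof eventually_elim
  case (elim \<omega>)
  show ?case
  proof
    fix r
    have "levy_modulus (exp (- r / 2) * sqrt (exp r)) (\<lambda>t. exp (- r / 2) * W (exp r) t \<omega>)"
      using elim by (intro levy_modulus_scale) auto
    moreover have "sqrt (exp r) = exp (r / 2)"
      by (rule real_sqrt_unique) (simp_all add: power2_eq_square exp_add[symmetric])
    then have "exp (- r / 2) * sqrt (exp r) = 1"
      by (simp add: exp_add[symmetric])
    ultimately show "levy_modulus 1 (OU_process W r \<omega>)"
      by (simp add: levy_modulus_def OU_process_def OU_sheet_def)
  qed
qed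

end

section \<open>Borel measurability of the set of paths with Levy's modulus\<close>

definition modulus_ratio :: "real \<Rightarrow> (real \<Rightarrow> real) \<Rightarrow> real" where
  "modulus_ratio \<epsilon> f = (SUP (u, v) \<in> {(u, v). u \<in> {0..1} \<and> v \<in> {0..1} \<and> \<bar>u - v\<bar> \<le> \<epsilon>}.
               \<bar>f u - f v\<bar> / sqrt (2 * \<epsilon> * ln (1 / \<epsilon>)))"

text \<open>At a fixed \<open>\<epsilon>\<close> the ratio is Lipschitz in the uniform metric, since
  each increment changes by at most twice the distance. The one-sided form gives both directions by
  exchanging \<open>f\<close> and \<open>g\<close>.\<close>

lemma modulus_ratio_diff:
  assumes \<epsilon>: "0 < \<epsilon>" "\<epsilon> < 1" and f: "f \<in> mspace Omega" and g: "g \<in> mspace Omega"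
    and fg: "mdist Omega f g \<le> a"
  shows "modulus_ratio \<epsilon> f \<le> modulus_ratio \<epsilon> g + 2 * a / levy_scale \<epsilon>"
proof -
  let ?D = "{(u, v). u \<in> {0..1 :: real} \<and> v \<in> {0..1} \<and> \<bar>u - v\<bar> \<le> \<epsilon>}"
  have h: "levy_scale \<epsilon> > 0" using \<epsilon> by (simp add: levy_scale_pos)
  have d: "\<bar>f t - g t\<bar> \<le> a" if "t \<in> {0..1}" for t
    using mdist_cfunspace_imp_mdist_le[of f "top_of_set {0..1}" euclidean_metric g a t] f g fg that
    by (simp add: Omega_def dist_real_def)
  \<comment> \<open>A supremum of reals dominates its family only when the family is bounded
    above.\<close>
  have "bounded (g ` {0..1})"
    using g unfolding Omega_def by simp
  then obtain B where "\<forall>x\<in>g ` {0..1}. norm x \<le> B" unfolding bounded_iff by blast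
  then have B: "\<bar>g t\<bar> \<le> B" if "t \<in> {0..1}" for t using that by simp
  have bdd: "bdd_above ((\<lambda>(u, v). \<bar>g u - g v\<bar> / levy_scale \<epsilon>) ` ?D)"
  proof (rule bdd_aboveI2)
    fix w assume "w \<in> ?D"
    then obtain u v where w: "w = (u, v)" "u \<in> {0..1}" "v \<in> {0..1}" by auto
    have "\<bar>g u - g v\<bar> \<le> 2 * B" using B[of u] B[of v] w by linarith
    then show "(case w of (u, v) \<Rightarrow> \<bar>g u - g v\<bar> / levy_scale \<epsilon>) \<le> 2 * B / levy_scale \<epsilon>"
      using h by (simp add: w divide_right_mono)
  qed
  have "(SUP (u, v)\<in>?D. \<bar>f u - f v\<bar> / levy_scale \<epsilon>) \<le> (SUP (u, v)\<in>?D. \<bar>g u - g v\<bar> / levy_scale \<epsilon>) + 2 * a / levy_scale \<epsilon>"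
  proof (rule cSUP_least)
    show "?D \<noteq> {}" using \<epsilon> by (auto intro!: exI[of _ 0])
    fix w assume w: "w \<in> ?D"
    then obtain u v where uv: "w = (u, v)" "u \<in> {0..1}" "v \<in> {0..1}" by auto
    have "\<bar>f u - f v\<bar> \<le> \<bar>g u - g v\<bar> + 2 * a" using d[of u] d[of v] uv by linarith
    then have "\<bar>f u - f v\<bar> / levy_scale \<epsilon> \<le> \<bar>g u - g v\<bar> / levy_scale \<epsilon> + 2 * a / levy_scale \<epsilon>"
      using h by (simp add: add_divide_distrib[symmetric] divide_right_mono)
    moreover have "\<bar>g u - g v\<bar> / levy_scale \<epsilon> \<le> (SUP (u, v)\<in>?D. \<bar>g u - g v\<bar> / levy_scale \<epsilon>)"
      using cSUP_upper[OF w bdd] by (simp add: uv)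
    ultimately show "(case w of (u, v) \<Rightarrow> \<bar>f u - f v\<bar> / levy_scale \<epsilon>) \<le> (SUP (u, v)\<in>?D. \<bar>g u - g v\<bar> / levy_scale \<epsilon>) + 2 * a / levy_scale \<epsilon>"
      by (simp add: uv)
  qed
  then show ?thesis by (simp add: modulus_ratio_def levy_scale_def)
qed

lemma closedin_modulus_ratio:
  assumes \<epsilon>: "0 < \<epsilon>" "\<epsilon> < 1"
  shows "closedin (mtopology_of Omega) {f \<in> mspace Omega. \<bar>modulus_ratio \<epsilon> f - 1\<bar> \<le> b}"
proof -
  let ?C = "{f \<in> mspace Omega. \<bar>modulus_ratio \<epsilon> f - 1\<bar> \<le> b}"
  have h: "levy_scale \<epsilon> > 0" using \<epsilon> by (simp add: levy_scale_pos)
  interpret O: Metric_space "mspace Omega" "mdist Omega" by simp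
  have "\<exists>r>0. disjnt ?C (O.mball f r)" if f: "f \<in> mspace Omega - ?C" for f
  proof (intro exI conjI)
    \<comment> \<open>Within distance \<open>r\<close> the ratio moves by at most \<open>d\<close>,
      which is half of the gap by which \<open>f\<close> violates the bound, so \<open>g\<close>
      still violates it.\<close>
    define r where "r = (\<bar>modulus_ratio \<epsilon> f - 1\<bar> - b) * levy_scale \<epsilon> / 4"
    have gt: "\<bar>modulus_ratio \<epsilon> f - 1\<bar> > b" using f by auto
    then show "r > 0" using h by (simp add: r_def)
    define d where "d = 2 * r / levy_scale \<epsilon>"
    have d: "2 * d = \<bar>modulus_ratio \<epsilon> f - 1\<bar> - b" using h by (simp add: d_def r_def)
    show "disjnt ?C (O.mball f r)"
    unfolding disjnt_iff
    proof safe
      fix g assume "g \<in> O.mball f r" and b: "\<bar>modulus_ratio \<epsilon> g - 1\<bar> \<le> b"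
      then have "g \<in> mspace Omega" "f \<in> mspace Omega" "mdist Omega f g \<le> r" "mdist Omega g f \<le> r"
        by (auto simp: O.commute)
      then have "modulus_ratio \<epsilon> f \<le> modulus_ratio \<epsilon> g + d"
        "modulus_ratio \<epsilon> g \<le> modulus_ratio \<epsilon> f + d"
        unfolding d_def using modulus_ratio_diff[OF \<epsilon>] by blast+
      then show False using b gt d by linarith
    qed
  qed
  then have "closedin O.mtopology ?C" unfolding O.closedin_metric by blast
  then show ?thesis by (simp add: mtopology_of_def)
qed

text \<open>The limit is taken along all real \<open>\<epsilon>\<close>, but arbitrary intersections of closed sets are closed.\<close>
lemma levy_set_borel: "{f \<in> mspace Omega. ((\<lambda>\<epsilon>. modulus_ratio \<epsilon> f) \<longlongrightarrow> 1) (at_right 0)} \<in> sets borel_Omega"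
proof -
  \<comment> \<open>\<open>k\<close> is the tolerance and \<open>n\<close> the threshold for
    \<open>\<epsilon>\<close>, so that convergence becomes \<open>\<forall>k. \<exists>n.\<close>
    over closed sets. All \<open>\<epsilon>\<close> involved lie below 1/2, inside the range where
    \<open>closedin_modulus_ratio\<close> applies.\<close>
  define C where "C k n = (\<Inter>\<epsilon>\<in>{0<..<1 / real (Suc (Suc n))}.
      {f \<in> mspace Omega. \<bar>modulus_ratio \<epsilon> f - 1\<bar> \<le> 1 / real (Suc k)})" for k n :: nat
  have ne: "{0<..<1 / real (Suc (Suc n))} \<noteq> {}" for n :: nat by simp
  have C: "closedin (mtopology_of Omega) (C k n)" for k n
    unfolding C_def
  proof (rule closedin_INT[OF ne closedin_modulus_ratio])
    fix \<epsilon> assume \<epsilon>: "\<epsilon> \<in> {0<..<1 / real (Suc (Suc n))}"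
    then show "0 < \<epsilon>" by simp
    have "\<epsilon> < 1 / real (Suc (Suc n))" using \<epsilon> by simp
    also have "\<dots> \<le> 1" by simp
    finally show "\<epsilon> < 1" .
  qed
  have sp: "{A. openin (mtopology_of Omega) A} \<subseteq> Pow (mspace Omega)"
    using openin_subset[of "mtopology_of Omega"] by auto
  have sB: "sets borel_Omega = sigma_sets (mspace Omega) {A. openin (mtopology_of Omega) A}"
    unfolding borel_Omega_def using sp by simp
  have CB: "C k n \<in> sets borel_Omega" for k n
  proof -
    have "openin (mtopology_of Omega) (mspace Omega - C k n)"
      using C[of k n] by (auto simp: closedin_def)
    then have "mspace Omega - (mspace Omega - C k n) \<in> sets borel_Omega"
      unfolding sB by (intro sigma_sets.Compl sigma_sets.Basic) auto
    moreover have "mspace Omega - (mspace Omega - C k n) = C k n"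
      using closedin_subset[OF C[of k n]] by auto
    ultimately show ?thesis by simp
  qed
  have iff: "((\<lambda>\<epsilon>. modulus_ratio \<epsilon> f) \<longlongrightarrow> 1) (at_right 0) \<longleftrightarrow> (\<forall>k. \<exists>n. f \<in> C k n)" if f: "f \<in> mspace Omega" for f
  proof
    assume lim: "((\<lambda>\<epsilon>. modulus_ratio \<epsilon> f) \<longlongrightarrow> 1) (at_right 0)"
    show "\<forall>k. \<exists>n. f \<in> C k n"
    proof
      fix k :: nat
      have "0 < 1 / real (Suc k)" by simp
      from tendstoD[OF lim this] obtain b where b: "b > 0"
        "\<And>\<epsilon>. 0 < \<epsilon> \<Longrightarrow> \<epsilon> < b \<Longrightarrow> dist (modulus_ratio \<epsilon> f) 1 < 1 / real (Suc k)"
        unfolding eventually_at_right_field by blast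
      obtain n where n: "1 / real (Suc n) < b"
        using reals_Archimedean[OF b(1)] by (auto simp: inverse_eq_divide)
      have "1 / real (Suc (Suc n)) \<le> 1 / real (Suc n)" by (intro divide_left_mono) auto
      with n have "f \<in> C k n"
        unfolding C_def using b(2) f by (auto simp: dist_real_def intro!: less_imp_le)
      then show "\<exists>n. f \<in> C k n" ..
    qed
  next
    assume all: "\<forall>k. \<exists>n. f \<in> C k n"
    show "((\<lambda>\<epsilon>. modulus_ratio \<epsilon> f) \<longlongrightarrow> 1) (at_right 0)"
    proof (rule tendstoI)
      fix e :: real assume "e > 0"
      then obtain k where k: "1 / real (Suc k) < e"
        using reals_Archimedean by (auto simp: inverse_eq_divide)
      obtain n where n: "f \<in> C k n" using all by blast
      have "dist (modulus_ratio \<epsilon> f) 1 < e" if "0 < \<epsilon>" "\<epsilon> < 1 / real (Suc (Suc n))" for \<epsilon>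
      proof -
        have "\<bar>modulus_ratio \<epsilon> f - 1\<bar> \<le> 1 / real (Suc k)"
          using INT_D[OF n[unfolded C_def], of \<epsilon>] that by simp
        with k show ?thesis unfolding dist_real_def by linarith
      qed
      then show "\<forall>\<^sub>F \<epsilon> in at_right 0. dist (modulus_ratio \<epsilon> f) 1 < e"
        unfolding eventually_at_right_field by (intro exI[of _ "1 / real (Suc (Suc n))"]) auto
    qed
  qed
  have sub: "C k n \<subseteq> mspace Omega" for k n
    using closedin_subset[OF C[of k n]] by simp
  have "{f \<in> mspace Omega. ((\<lambda>\<epsilon>. modulus_ratio \<epsilon> f) \<longlongrightarrow> 1) (at_right 0)} = (\<Inter>k. \<Union>n. C k n)"
  proof (intro equalityI subsetI)
    fix f assume "f \<in> (\<Inter>k. \<Union>n. C k n)"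
    then have all: "\<forall>k. \<exists>n. f \<in> C k n" by auto
    then have "f \<in> mspace Omega" using sub by blast
    with all show "f \<in> {f \<in> mspace Omega. ((\<lambda>\<epsilon>. modulus_ratio \<epsilon> f) \<longlongrightarrow> 1) (at_right 0)}"
      by (simp add: iff)
  qed (auto simp: iff)
  also have "\<dots> \<in> sets borel_Omega" using CB by auto
  finally show ?thesis .
qed

theorem theorem5p2:
  fixes M :: "'a measure" and W :: "real \<Rightarrow> real \<Rightarrow> 'a \<Rightarrow> real"
  assumes "brownian_sheet M W"
  shows "quasi_surely M W
    {f \<in> mspace Omega.
       ((\<lambda>\<epsilon>. SUP (u, v) \<in> {(u, v). u \<in> {0..1} \<and> v \<in> {0..1} \<and> \<bar>u - v\<bar> \<le> \<epsilon>}.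
               \<bar>f u - f v\<bar> / sqrt (2 * \<epsilon> * ln (1 / \<epsilon>))) \<longlongrightarrow> 1) (at_right 0)}"
  (is "quasi_surely M W ?G")
proof -
  interpret sheet M W by standard (rule assms)
  have "AE \<omega> in M. \<forall>r. OU_process W r \<omega> \<notin> mspace Omega - ?G"
    using OU_process_levy_modulus by eventually_elim (use levy_modulus_tendsto in blast)
  then obtain N where N: "N \<in> null_sets M" "{\<omega>\<in>space M. \<not> (\<forall>r. OU_process W r \<omega> \<notin> mspace Omega - ?G)} \<subseteq> N"
    by (rule AE_E) (auto intro: null_setsI)
  \<comment> \<open>The single null set \<open>N\<close> serves every \<open>r\<close>, hence covers
    the hitting event of every horizon \<open>s\<close>. Covering is all that the outer measure asks
    for, so measurability of that event is never at issue.\<close>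
  have "outer_measure_of M {\<omega>\<in>space M. \<exists>r\<in>{0..s}. OU_process W r \<omega> \<in> mspace Omega - ?G} = 0" for s
  proof -
    have "outer_measure_of M {\<omega>\<in>space M. \<exists>r\<in>{0..s}. OU_process W r \<omega> \<in> mspace Omega - ?G} \<le> emeasure M N"
      unfolding outer_measure_of_def using N by (intro INF_lower) auto
    then show ?thesis using N by auto
  qed
  then have "Cap M W (mspace Omega - ?G) = 0"
    unfolding Cap_def by simp
  then show ?thesis
    using levy_set_borel unfolding quasi_surely_def modulus_ratio_def by blast
qed

end
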